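(* Consider an $M$-step Adams--Bashforth or Adams--Moulton scheme of order $p$, with its auxiliary discovery matrix $A_h$ and auxiliary loss $J_{a,h}$ built from the samples of the trajectory $\mathbf{x}$ of $\dot{\mathbf{x}}=\mathbf{f}(\mathbf{x})$, $\mathbf{x}(0)=\mathbf{x}_{\rm init}$, on $[0,T]$. Suppose $\mathbf{x}\in C^\infty([0,T])^d$ and that $\mathbf{f}$ is defined in a small neighborhood of the trajectory $\mathcal{T}=\{\mathbf{x}(t):0\le t\le T\}$. Let $f$ be a scalar component of $\mathbf{f}$. Assume that $\hat f_{\mathcal{A},h}\in\mathcal{A}$ is a global minimizer of $J_{a,h}$ over the admissible class $\mathcal{A}$ and that $\hat f_{\mathcal{A},h}\in\mathcal{A}_{\tilde R}$ for some constant $\tilde R>0$ independent of $h$. Then $$\int_0^T\big|\hat f_{\mathcal{A},h}(\mathbf{x}(t))-f(\mathbf{x}(t))\big|\,dt\le C\Big(\kappa_2(A_h)\,(h^p+e_{\mathcal{A}})+\tilde R\,h^p\Big),$$ where $C$ is a constant independent of $h$ and $\mathcal{A}$, $\kappa_2(A_h)$ is the $2$-norm condition number of $A_h$, and $e_{\mathcal{A}}$ is any number satisfying $e_{\mathcal{A}}>\inf_{u\in\mathcal{A}}\sup_{z\in\Omega_{\mathcal{T}}}|u(z)-f(z)|$.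
   Context: Data. $\mathbf{x}:[0,T]\to\mathbb{R}^d$ solves $\dot{\mathbf{x}}=\mathbf{f}(\mathbf{x})$, $\mathbf{x}(0)=\mathbf{x}_{\rm init}$. For $N\in\mathbb{N}$ put $h=T/N$, $t_n=nh$, $\mathbf{x}_n=\mathbf{x}(t_n)$, $0\le n\le N$. $f$ denotes one fixed component of $\mathbf{f}$ and $x_n$ the corresponding scalar component of $\mathbf{x}_n$. $\Omega_{\mathcal{T}}\subset\mathbb{R}^d$ is a fixed neighborhood of $\mathcal{T}$ (on which $\mathbf{f}$ is defined), and the admissible class $\mathcal{A}$ is a subset of $C(\Omega_{\mathcal{T}})$. Schemes. Both families are $x_n-x_{n-1}=h\sum_{m=0}^M\beta_mf_{n-m}$ (i.e. $\alpha_0=1,\alpha_1=-1$, other $\alpha_m=0$). For the $M$-step Adams--Bashforth (A-B) scheme $\beta_0=0$ and $\beta_m=\frac{(-1)^{m-1}}{(m-1)!(M-m)!}\int_0^1\prod_{i=0,i\ne m-1}^{M-1}(u+i)\,du$ for $1\le m\le M$ (order $p=M$). For the $M$-step Adams--Moulton (A-M) scheme $\beta_m=\frac{(-1)^m}{m!(M-m)!}\int_0^1\prod_{i=0,i\ne m}^{M}(u+i-1)\,du$ for $0\le m\le M$ (order $p=M+1$). Discovery system. The involved time indices are $\mathcal{I}_h=\{0,\ldots,e(N)\}$ with $e(N)=N-1$ for A-B and $e(N)=N$ for A-M; $t(N)=e(N)+1$. The matrix $B_h\in\mathbb{R}^{(N-M+1)\times t(N)}$ is defined by $(B_hv)_n=\sum_{m}\beta_mv_{n-m}$,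 $n=M,\ldots,N$ (sum over $1\le m\le M$ for A-B, $0\le m\le M$ for A-M), for $v=(v_0,\ldots,v_{e(N)})^\top$, and $q_h\in\mathbb{R}^{N-M+1}$ has entries $h^{-1}\sum_{m=0}^M\alpha_mx_{n-m}$, $n=M,\ldots,N$. Auxiliary conditions. Let $N_a=t(N)-(N-M+1)$ (so $N_a=M-1$ for A-B, $N_a=M$ for A-M). Let $\gamma_0,\ldots,\gamma_p$ be fixed one-sided finite-difference coefficients (independent of $h$) such that $h^{-1}\sum_{m=0}^p\gamma_mx_{r+m}$ approximates $f(\mathbf{x}_r)$ with error $O(h^p)$ along the exact trajectory. Let $\hat B_h\in\mathbb{R}^{N_a\times t(N)}$ select the first $N_a$ entries of a vector in $\mathbb{R}^{t(N)}$, and let $c_h\in\mathbb{R}^{N_a}$ have entries $h^{-1}\sum_{m=0}^p\gamma_mx_{r+m}$, $r=0,\ldots,N_a-1$ ($N$ is taken large enough that $N\ge M$ and all samples used exist). Set $A_h=\begin{bmatrix}\hat B_h\\ B_h\end{bmatrix}\in\mathbb{R}^{t(N)\times t(N)}$ and $d_h=\begin{bmatrix}c_h\\ q_h\end{bmatrix}$. For $u\in\mathcal{A}$ let $\mathbf{u}=(u(\mathbf{x}_0),\ldots,u(\mathbf{x}_{e(N)}))^\top$; the auxiliary loss is $J_{a,h}(u)=\frac{1}{t(N)}\|A_h\mathbf{u}-d_h\|_2^2$. Trace regularity class. For $\tilde R>0$, $\mathcal{A}_{\tilde R}$ is the set of $u\in\mathcal{A}$ such that $g(t)=u(\mathbf{x}(t))-f(\mathbf{x}(t))$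 belongs to the Sobolev space $H^p(0,T)$ with seminorm $|g|_{H^p(0,T)}=\|g^{(p)}\|_{L^2(0,T)}\le\tilde R$. *)

theory Defs
  imports
    "HOL-Analysis.Analysis"
    "HOL-Library.Landau_Symbols"
    "Jordan_Normal_Form.Gauss_Jordan_Elimination"
begin

(* Entries of Jordan_Normal_Form vectors are written with vec_index below, so that $ is left to
   the components of points of real^'d. *)
no_notation vec_index (infixl \<open>$\<close> 100)


section \<open>Adams schemes\<close>

datatype adams = AB | AM

fun adams_order :: "adams \<Rightarrow> nat \<Rightarrow> nat" where
  "adams_order AB M = M"
| "adams_order AM M = M + 1"

fun adams_alpha :: "nat \<Rightarrow> real" where
  "adams_alpha m = (if m = 0 then 1 else if m = 1 then - 1 else 0)"

text \<open>The smallest lag \<open>m\<close> with \<open>\<beta>\<^sub>m \<noteq> 0\<close>: explicit against implicit scheme.\<close>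

fun first_lag :: "adams \<Rightarrow> nat" where
  "first_lag AB = 1"
| "first_lag AM = 0"

text \<open>In both cases the polynomial under the integral is a Lagrange basis polynomial, up to
  normalisation, in the time \<open>u\<close> measured in steps. The values outside the index range of the
  scheme (in particular \<open>m = 0\<close> for \<open>AB\<close>) are 0.\<close>

fun adams_beta :: "adams \<Rightarrow> nat \<Rightarrow> nat \<Rightarrow> real" where
  "adams_beta AB M m =
     (if 1 \<le> m \<and> m \<le> M
      then (- 1) ^ (m - 1) / (fact (m - 1) * fact (M - m)) *
           integral {0..1} (\<lambda>u. \<Prod>i\<in>{0..M - 1} - {m - 1}. u + real i)
      else 0)"
| "adams_beta AM M m =
     (if m \<le> M
      then (- 1) ^ m / (fact m * fact (M - m)) *
           integral {0..1} (\<lambda>u. \<Prod>i\<in>{0..M} - {m}. u + real i - 1)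
      else 0)"


section \<open>Discovery system with auxiliary conditions\<close>

fun last_index :: "adams \<Rightarrow> nat \<Rightarrow> nat" where
  "last_index AB N = N - 1"
| "last_index AM N = N"

definition num_unknowns :: "adams \<Rightarrow> nat \<Rightarrow> nat" where
  "num_unknowns s N = last_index s N + 1"

text \<open>The number \<open>N\<^sub>a\<close> of auxiliary conditions does not depend on \<open>N\<close>;
  see \<open>num_aux_eq\<close>.\<close>

fun num_aux :: "adams \<Rightarrow> nat \<Rightarrow> nat" where
  "num_aux AB M = M - 1"
| "num_aux AM M = M"

lemma num_aux_eq:
  assumes "1 \<le> M" "M \<le> N"
  shows "num_aux s M = num_unknowns s N - (N - M + 1)"
    and "num_unknowns s N = num_aux s M + (N - M + 1)"
  using assms by (cases s; simp add: num_unknowns_def)+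

definition step :: "real \<Rightarrow> nat \<Rightarrow> real" where
  "step T N = T / real N"

definition grid :: "real \<Rightarrow> nat \<Rightarrow> nat \<Rightarrow> real" where
  "grid T N n = real n * step T N"

text \<open>Row \<open>r\<close> belongs to the time index \<open>n = r + M\<close>, so the entry in column \<open>j\<close> is
  \<open>\<beta>\<^bsub>n - j\<^esub>\<close>; see \<open>B_mat_mult\<close>.\<close>

definition B_mat :: "adams \<Rightarrow> nat \<Rightarrow> nat \<Rightarrow> real mat" where
  "B_mat s M N = Matrix.mat (N - M + 1) (num_unknowns s N)
     (\<lambda>(r, j). if j \<le> r + M then adams_beta s M (r + M - j) else 0)"

lemma B_mat_mult:
  assumes "1 \<le> M" "M \<le> n" "n \<le> N" "v \<in> carrier_vec (num_unknowns s N)"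
  shows "vec_index (B_mat s M N *\<^sub>v v) (n - M) =
    (\<Sum>m\<in>{first_lag s..M}. adams_beta s M m * vec_index v (n - m))"
proof -
  let ?t = "num_unknowns s N" and ?l = "first_lag s"
  have "vec_index (B_mat s M N *\<^sub>v v) (n - M) =
      (\<Sum>j\<in>{0..<?t}. (if j \<le> n then adams_beta s M (n - j) else 0) * vec_index v j)"
    using assms by (auto simp: B_mat_def scalar_prod_def intro!: sum.cong)
  also have "\<dots> = (\<Sum>j\<in>{n - M..n - ?l}. adams_beta s M (n - j) * vec_index v j)"
    using assms
    by (cases s; intro sum.mono_neutral_cong_right) (auto simp: num_unknowns_def)
  also have "\<dots> = (\<Sum>m\<in>{?l..M}. adams_beta s M m * vec_index v (n - m))"
    using assms
    by (cases s; intro sum.reindex_bij_witness[of _ "\<lambda>m. n - m" "\<lambda>j. n - j"]) auto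
  finally show ?thesis .
qed

text \<open>Here and below \<open>y\<close> is the scalar component of the trajectory that is sampled.\<close>

definition q_vec :: "real \<Rightarrow> (real \<Rightarrow> real) \<Rightarrow> nat \<Rightarrow> nat \<Rightarrow> real Matrix.vec" where
  "q_vec T y M N = Matrix.vec (N - M + 1)
     (\<lambda>r. (\<Sum>m = 0..M. adams_alpha m * y (grid T N (r + M - m))) / step T N)"

definition B_aux :: "adams \<Rightarrow> nat \<Rightarrow> nat \<Rightarrow> real mat" where
  "B_aux s M N = Matrix.mat (num_aux s M) (num_unknowns s N) (\<lambda>(r, j). if j = r then 1 else 0)"

definition one_sided_diff ::
  "real \<Rightarrow> (real \<Rightarrow> real) \<Rightarrow> (nat \<Rightarrow> real) \<Rightarrow> nat \<Rightarrow> nat \<Rightarrow> nat \<Rightarrow> real" where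
  "one_sided_diff T y \<gamma> p N r = (\<Sum>m = 0..p. \<gamma> m * y (grid T N (r + m))) / step T N"

definition c_vec ::
  "adams \<Rightarrow> real \<Rightarrow> (real \<Rightarrow> real) \<Rightarrow> (nat \<Rightarrow> real) \<Rightarrow> nat \<Rightarrow> nat \<Rightarrow> real Matrix.vec" where
  "c_vec s T y \<gamma> M N = Matrix.vec (num_aux s M) (one_sided_diff T y \<gamma> (adams_order s M) N)"

definition A_mat :: "adams \<Rightarrow> nat \<Rightarrow> nat \<Rightarrow> real mat" where
  "A_mat s M N = B_aux s M N @\<^sub>r B_mat s M N"

definition d_vec ::
  "adams \<Rightarrow> real \<Rightarrow> (real \<Rightarrow> real) \<Rightarrow> (nat \<Rightarrow> real) \<Rightarrow> nat \<Rightarrow> nat \<Rightarrow> real Matrix.vec" where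
  "d_vec s T y \<gamma> M N = c_vec s T y \<gamma> M N @\<^sub>v q_vec T y M N"

definition enough_samples :: "adams \<Rightarrow> nat \<Rightarrow> nat \<Rightarrow> bool" where
  "enough_samples s M N \<longleftrightarrow> M \<le> N \<and> (\<forall>r < num_aux s M. r + adams_order s M \<le> N)"


section \<open>Norms, condition number and loss\<close>

definition norm2_vec :: "real Matrix.vec \<Rightarrow> real" where
  "norm2_vec v = L2_set (vec_index v) {0..<dim_vec v}"

definition norm2_mat :: "real mat \<Rightarrow> real" where
  "norm2_mat A = (SUP v\<in>{v \<in> carrier_vec (dim_col A). norm2_vec v = 1}. norm2_vec (A *\<^sub>v v))"

text \<open>Meaningful for invertible matrices only. \<open>A_mat s M N\<close> is lower triangular with diagonal
  entries 1 and \<open>\<beta>\<^sub>1\<close> (for \<open>AB\<close>) or \<open>\<beta>\<^sub>0\<close> (for \<open>AM\<close>), which are positive.\<close>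

definition cond2 :: "real mat \<Rightarrow> real" where
  "cond2 A = norm2_mat A * norm2_mat (the (mat_inverse A))"

definition sample_vec ::
  "adams \<Rightarrow> real \<Rightarrow> (real \<Rightarrow> 'a) \<Rightarrow> nat \<Rightarrow> ('a \<Rightarrow> real) \<Rightarrow> real Matrix.vec" where
  "sample_vec s T x N u = Matrix.vec (num_unknowns s N) (\<lambda>n. u (x (grid T N n)))"

definition aux_loss ::
  "adams \<Rightarrow> real \<Rightarrow> (real \<Rightarrow> real^'d) \<Rightarrow> 'd \<Rightarrow> (nat \<Rightarrow> real) \<Rightarrow> nat \<Rightarrow> nat
    \<Rightarrow> (real^'d \<Rightarrow> real) \<Rightarrow> real" where
  "aux_loss s T x i \<gamma> M N u =
     (norm2_vec (A_mat s M N *\<^sub>v sample_vec s T x N u - d_vec s T (\<lambda>t. x t $ i) \<gamma> M N))\<^sup>2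
       / real (num_unknowns s N)"


section \<open>Smoothness and Sobolev spaces on an interval\<close>

text \<open>\<open>C\<^sup>\<infinity>\<close> on the closed interval: \<open>X k\<close> is the \<open>k\<close>-th derivative, one-sided at the end points.\<close>

definition smooth_on_interval :: "real \<Rightarrow> real \<Rightarrow> (real \<Rightarrow> 'a::real_normed_vector) \<Rightarrow> bool" where
  "smooth_on_interval a b x \<longleftrightarrow>
     (\<exists>X. X 0 = x \<and>
       (\<forall>k. \<forall>t\<in>{a..b}. (X k has_vector_derivative X (Suc k) t) (at t within {a..b})))"

text \<open>\<open>C\<^sub>c\<^sup>\<infinity>(a, b)\<close>; the closure of the support is bounded, hence compact.\<close>

definition test_function :: "real \<Rightarrow> real \<Rightarrow> (real \<Rightarrow> real) \<Rightarrow> bool" where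
  "test_function a b \<phi> \<longleftrightarrow>
     (\<forall>k t. (deriv ^^ k) \<phi> field_differentiable at t) \<and>
     closure {t. \<phi> t \<noteq> 0} \<subseteq> {a<..<b}"

definition square_integrable :: "real \<Rightarrow> real \<Rightarrow> (real \<Rightarrow> real) \<Rightarrow> bool" where
  "square_integrable a b g \<longleftrightarrow>
     g \<in> borel_measurable (lebesgue_on {a<..<b}) \<and>
     integrable (lebesgue_on {a<..<b}) (\<lambda>t. (g t)\<^sup>2)"

definition L2_norm :: "real \<Rightarrow> real \<Rightarrow> (real \<Rightarrow> real) \<Rightarrow> real" where
  "L2_norm a b g = sqrt (LINT t|lebesgue_on {a<..<b}. (g t)\<^sup>2)"

definition weak_derivative ::
  "real \<Rightarrow> real \<Rightarrow> nat \<Rightarrow> (real \<Rightarrow> real) \<Rightarrow> (real \<Rightarrow> real) \<Rightarrow> bool" where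
  "weak_derivative a b k g w \<longleftrightarrow>
     (\<forall>\<phi>. test_function a b \<phi> \<longrightarrow>
        (LINT t|lebesgue_on {a<..<b}. g t * (deriv ^^ k) \<phi> t) =
        (- 1) ^ k * (LINT t|lebesgue_on {a<..<b}. w t * \<phi> t))"

definition sobolev_H :: "nat \<Rightarrow> real \<Rightarrow> real \<Rightarrow> (real \<Rightarrow> real) set" where
  "sobolev_H p a b =
     {g. square_integrable a b g \<and>
         (\<forall>k\<in>{1..p}. \<exists>w. square_integrable a b w \<and> weak_derivative a b k g w)}"

text \<open>The weak derivative is unique only almost everywhere; its norm does not depend on the
  choice.\<close>

definition sobolev_seminorm :: "nat \<Rightarrow> real \<Rightarrow> real \<Rightarrow> (real \<Rightarrow> real) \<Rightarrow> real" where
  "sobolev_seminorm p a b g =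
     L2_norm a b (SOME w. square_integrable a b w \<and> weak_derivative a b p g w)"

definition trace_class ::
  "nat \<Rightarrow> real \<Rightarrow> (real \<Rightarrow> 'a) \<Rightarrow> ('a \<Rightarrow> real) \<Rightarrow> ('a \<Rightarrow> real) set \<Rightarrow> real
    \<Rightarrow> ('a \<Rightarrow> real) set" where
  "trace_class p T x f \<A> R =
     {u \<in> \<A>. (\<lambda>t. u (x t) - f (x t)) \<in> sobolev_H p 0 T \<and>
             sobolev_seminorm p 0 T (\<lambda>t. u (x t) - f (x t)) \<le> R}"

end

theory Submission
  imports Defs "Jordan_Normal_Form.Determinant"
begin

text \<open>
The quantity to be estimated is the \<open>L\<^sup>1\<close> norm over time of the error \<open>g t = fhat (x t) - f (x t)\<close>
along the trajectory. The argument has a discrete and a continuous half.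

On the grid, the exact values of \<open>f\<close> nearly solve the linear system: the trajectory is smooth, so
the residual has entries of size \<open>O(h\<^sup>p)\<close>, by the truncation error of the Adams scheme
(\<open>adams_truncation_error\<close>) and by assumption in the auxiliary rows. The class contains some \<open>u\<close>
within \<open>e\<close> of \<open>f\<close> in the supremum norm, and the loss of the minimiser is no larger than that of \<open>u\<close>.
Inverting the system bounds the root mean square of the grid values of \<open>g\<close> by the condition
number times \<open>h\<^sup>p + e\<close> (\<open>minimizer_error_le_cond2\<close>); the matrix is invertible since it is
triangular with positive diagonal, and its norm is at least \<open>1\<close>, so the truncation error too may be weighted with the
condition number.

Between grid points, \<open>g\<close> is only known to be continuous with a square integrable weak \<open>p\<close>-th
derivative \<open>w\<close>. Its distance from the Lagrange interpolant through \<open>p\<close> neighbouring grid points is a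
combination of point values that annihilates polynomials of degree less than \<open>p\<close>. Testing the
definition of the weak derivative with a smoothed B-spline bounds every such combination by the
integral of \<open>\<bar>w\<bar>\<close> over the panel (\<open>weak_derivative_functional_bound\<close>). Since panels overlap boundedly, summation gives the
\<open>sampling_inequality\<close>: \<open>\<integral> \<bar>g\<bar>\<close> is at most a constant times the mean absolute grid value plus
\<open>h\<^sup>p \<integral> \<bar>w\<bar>\<close>, and \<open>\<integral> \<bar>w\<bar> \<le> sqrt T * R\<close> by Cauchy--Schwarz.
\<close>

section \<open>Smooth bump functions and their iterated antiderivatives\<close>

text \<open>
Differentiability of order \<open>n\<close> by recursion on \<open>n\<close>, with existentially quantified derivatives, so
that closure properties are one-step inductions and no formula for a higher derivative is needed.
\<close>

fun times_differentiable :: "nat \<Rightarrow> (real \<Rightarrow> real) \<Rightarrow> bool" where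
  "times_differentiable 0 f \<longleftrightarrow> True"
| "times_differentiable (Suc n) f \<longleftrightarrow>
     (\<exists>f'. (\<forall>t. (f has_real_derivative f' t) (at t)) \<and> times_differentiable n f')"

lemma times_differentiable_SucI:
  "(\<And>t. (f has_real_derivative f' t) (at t)) \<Longrightarrow> times_differentiable n f' \<Longrightarrow>
    times_differentiable (Suc n) f"
  by auto

lemma times_differentiable_SucD: "times_differentiable (Suc n) f \<Longrightarrow> times_differentiable n f"
  by (induction n arbitrary: f) auto

lemma times_differentiable_add:
  "times_differentiable n f \<Longrightarrow> times_differentiable n g \<Longrightarrow> times_differentiable n (\<lambda>t. f t + g t)"
proof (induction n arbitrary: f g)
  case (Suc n)
  from Suc.prems obtain f' g' where
    f: "\<forall>t. (f has_real_derivative f' t) (at t)" "times_differentiable n f'" and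
    g: "\<forall>t. (g has_real_derivative g' t) (at t)" "times_differentiable n g'"
    unfolding times_differentiable.simps by blast
  from f(2) g(2) have "times_differentiable n (\<lambda>t. f' t + g' t)" by (rule Suc.IH)
  then show ?case
    by (rule times_differentiable_SucI[OF DERIV_add[OF spec[OF f(1)] spec[OF g(1)]]])
qed simp

lemma times_differentiable_mult:
  "times_differentiable n f \<Longrightarrow> times_differentiable n g \<Longrightarrow> times_differentiable n (\<lambda>t. f t * g t)"
proof (induction n arbitrary: f g)
  case (Suc n)
  from Suc.prems obtain f' g' where
    f: "\<forall>t. (f has_real_derivative f' t) (at t)" "times_differentiable n f'" and
    g: "\<forall>t. (g has_real_derivative g' t) (at t)" "times_differentiable n g'"
    unfolding times_differentiable.simps by blast
  have f0: "times_differentiable n f" and g0: "times_differentiable n g"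
    using Suc.prems by (auto dest: times_differentiable_SucD simp del: times_differentiable.simps)
  have "times_differentiable n (\<lambda>t. f' t * g t + g' t * f t)"
    by (intro times_differentiable_add Suc.IH f g f0 g0)
  then show ?case
    by (rule times_differentiable_SucI[OF DERIV_mult[OF spec[OF f(1)] spec[OF g(1)]]])
qed simp

lemma times_differentiable_const: "times_differentiable n (\<lambda>t. c)"
  by (induction n arbitrary: c) (auto intro!: exI[of _ "\<lambda>t. 0"])

lemma times_differentiable_reflect:
  "times_differentiable n f \<Longrightarrow> times_differentiable n (\<lambda>t. f (1 - t))"
proof (induction n arbitrary: f)
  case (Suc n)
  from Suc.prems obtain f' where
    f: "\<forall>t. (f has_real_derivative f' t) (at t)" "times_differentiable n f'"
    unfolding times_differentiable.simps by blast
  have 1: "times_differentiable n (\<lambda>t. f' (1 - t) * - 1)"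
    by (intro times_differentiable_mult times_differentiable_const Suc.IH f)
  have 2: "((\<lambda>t. f (1 - t)) has_real_derivative f' (1 - t) * - 1) (at t)" for t
  proof (rule DERIV_chain2[where f = f and g = "\<lambda>t. 1 - t"])
    show "((\<lambda>t. 1 - t) has_real_derivative - 1) (at t)" by (auto intro!: derivative_eq_intros)
  qed (simp add: f(1))
  show ?case by (rule times_differentiable_SucI[OF 2 1])
qed simp

text \<open>
The derivatives chosen at different orders agree because derivatives are unique; hence the
separate statements for each \<open>n\<close> yield one infinite sequence.
\<close>

lemma deriv_sequence_if_times_differentiable:
  assumes "\<And>n. times_differentiable n f"
  obtains X where "X 0 = f" "\<And>k t. (X k has_real_derivative X (Suc k) t) (at t)"
proof -
  have step: "\<exists>f'. (\<forall>t. (h has_real_derivative f' t) (at t)) \<and> f' = deriv h \<and> times_differentiable n f'"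
    if h: "times_differentiable (Suc n) h" for n h
  proof -
    from h obtain f' where f': "\<forall>t. (h has_real_derivative f' t) (at t)" "times_differentiable n f'"
      unfolding times_differentiable.simps by blast
    have "f' = deriv h" by (rule ext) (rule DERIV_imp_deriv[OF spec[OF f'(1)], symmetric])
    then show ?thesis using f' by blast
  qed
  have *: "times_differentiable n ((deriv ^^ k) f)" for n k
  proof (induction k arbitrary: n)
    case (Suc k)
    from step[OF Suc[of "Suc n"]] show ?case by auto
  qed (simp add: assms)
  show thesis
  proof (rule that[of "\<lambda>k. (deriv ^^ k) f"])
    show "((deriv ^^ k) f has_real_derivative (deriv ^^ Suc k) f t) (at t)" for k t
      using step[OF *[of "Suc 0" k]] by auto
  qed simp
qed

text \<open>
\<open>flat 0\<close> is the classical smooth function that vanishes to infinite order at \<open>0\<close>. The extra powers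
of \<open>1 / t\<close> make the span of the family closed under differentiation (\<open>flat_deriv\<close>), so smoothness
of all members is a single induction.
\<close>

definition flat :: "nat \<Rightarrow> real \<Rightarrow> real" where
  "flat k t = (if t \<le> 0 then 0 else exp (- 1 / t) / t ^ k)"

lemma flat_tendsto_0: "(flat k \<longlongrightarrow> 0) (at 0)"
proof -
  have "((\<lambda>t::real. inverse t ^ k / exp (inverse t)) \<longlongrightarrow> 0) (at_right 0)"
    by (rule filterlim_compose[OF tendsto_power_div_exp_0 filterlim_inverse_at_top_right])
  moreover have "\<forall>\<^sub>F t in at_right 0. inverse t ^ k / exp (inverse t) = flat k t"
    by (auto simp: eventually_at_filter flat_def exp_minus field_simps power_inverse)
  ultimately have "(flat k \<longlongrightarrow> 0) (at_right 0)"
    using tendsto_cong by fast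
  moreover have "(flat k \<longlongrightarrow> 0) (at_left 0)"
    by (rule tendsto_eventually) (auto simp: eventually_at_filter flat_def)
  ultimately show ?thesis
    by (simp add: filterlim_split_at)
qed

lemma flat_deriv: "(flat k has_real_derivative flat (k + 2) t - real k * flat (k + 1) t) (at t)"
proof -
  consider "t < 0" | "t = 0" | "t > 0" by linarith
  then show ?thesis
  proof cases
    case 1
    have "((\<lambda>_. 0) has_real_derivative 0) (at t)" by simp
    then have "(flat k has_real_derivative 0) (at t)"
      by (rule has_field_derivative_transform_within_open[where S = "{..<0}"])
        (use 1 in \<open>auto simp: flat_def\<close>)
    then show ?thesis using 1 by (simp add: flat_def)
  next
    case 2
    have "((\<lambda>y. (flat k y - flat k 0) / (y - 0)) \<longlongrightarrow> 0) (at 0)"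
      by (rule Lim_transform_eventually[OF flat_tendsto_0[of "Suc k"]])
        (auto simp: eventually_at_filter flat_def field_simps)
    then show ?thesis using 2 by (simp add: has_field_derivative_iff flat_def)
  next
    case 3
    have pow: "t ^ n = t * t ^ (n - Suc 0) \<or> n = 0" for n by (cases n) auto
    have "((\<lambda>t. exp (- 1 / t) / t ^ k) has_real_derivative
        flat (k + 2) t - real k * flat (k + 1) t) (at t)"
      using 3
      by (cases k)
        (auto intro!: derivative_eq_intros simp: flat_def field_simps power2_eq_square,
         use pow in blast)
    then show ?thesis
      by (rule has_field_derivative_transform_within_open[where S = "{0<..}"])
        (use 3 in \<open>auto simp: flat_def\<close>)
  qed
qed

lemma times_differentiable_flat: "times_differentiable n (flat k)"
proof (induction n arbitrary: k)
  case (Suc n)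
  have "times_differentiable n (\<lambda>t. flat (k + 2) t + (- real k) * flat (k + 1) t)"
    by (intro times_differentiable_add times_differentiable_mult times_differentiable_const Suc)
  then have "times_differentiable n (\<lambda>t. flat (k + 2) t - real k * flat (k + 1) t)"
    by simp
  then show ?case by (rule times_differentiable_SucI[OF flat_deriv])
qed simp

lemma integral_pos_if_pos_at_point:
  fixes f :: "real \<Rightarrow> real"
  assumes cont: "continuous_on {0..1} f" and nonneg: "\<And>u. u \<in> {0..1} \<Longrightarrow> 0 \<le> f u"
    and "u \<in> {0..1}" "0 < f u"
  shows "0 < integral {0..1} f"
proof (rule ccontr)
  assume "\<not> 0 < integral {0..1} f"
  moreover have "0 \<le> integral {0..1} f"
    using nonneg by (intro integral_nonneg integrable_continuous_real cont)
  ultimately have "(f has_integral 0) {0..1}"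
    using integrable_integral[OF integrable_continuous_real[OF cont]] by simp
  then have "f u = 0"
    using has_integral_0_cbox_imp_0[of 0 1 f u] cont nonneg \<open>u \<in> {0..1}\<close> by auto
  with \<open>0 < f u\<close> show False by simp
qed

text \<open>
The product of the flat function with its reflection at \<open>1/2\<close> is supported in \<open>[0, 1]\<close>; dividing by
its integral normalises it.
\<close>

lemma smooth_bump:
  obtains X :: "nat \<Rightarrow> real \<Rightarrow> real" where
    "\<And>k t. (X k has_real_derivative X (Suc k) t) (at t)"
    "\<And>t. 0 \<le> X 0 t" "\<And>t. t \<le> 0 \<or> 1 \<le> t \<Longrightarrow> X 0 t = 0" "(X 0 has_integral 1) {0..1}"
proof -
  define b where "b t = flat 0 t * flat 0 (1 - t)" for t
  have smooth: "times_differentiable n (\<lambda>t. c * b t)" for n c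
    unfolding b_def
    by (intro times_differentiable_mult times_differentiable_const times_differentiable_flat
        times_differentiable_reflect)
  obtain b' where "\<And>t. (b has_real_derivative b' t) (at t)"
    using smooth[of 1 1] by auto
  then have cont: "continuous_on {0..1} b"
    by (meson DERIV_isCont continuous_at_imp_continuous_on)
  have nonneg: "0 \<le> b t" for t
    by (simp add: b_def flat_def)
  define c where "c = integral {0..1} b"
  have "c > 0"
    unfolding c_def
    by (rule integral_pos_if_pos_at_point[OF cont nonneg, of "1/2"]) (simp_all add: b_def flat_def)
  obtain X where X: "X 0 = (\<lambda>t. (1 / c) * b t)"
    "\<And>k t. (X k has_real_derivative X (Suc k) t) (at t)"
    using deriv_sequence_if_times_differentiable[of "\<lambda>t. (1 / c) * b t"] smooth by blast
  have int: "(X 0 has_integral (1 / c) * c) {0..1}"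
    unfolding X(1) c_def
    by (intro has_integral_mult_right integrable_integral integrable_continuous_real cont)
  show thesis
  proof (rule that[of X, OF X(2)])
    show "0 \<le> X 0 t" for t using \<open>c > 0\<close> nonneg by (simp add: X(1))
    show "X 0 t = 0" if "t \<le> 0 \<or> 1 \<le> t" for t using that by (auto simp: X(1) b_def flat_def)
    show "(X 0 has_integral 1) {0..1}"
      using \<open>c > 0\<close> int by simp
  qed
qed

lemma antiderivative_vanishing_on_nonpos:
  fixes f f' :: "real \<Rightarrow> real"
  assumes "\<And>t. (f has_real_derivative f' t) (at t)" "\<And>t. t \<le> 0 \<Longrightarrow> f t = 0"
  obtains F where "\<And>t. (F has_real_derivative f t) (at t)" "\<And>t. t \<le> 0 \<Longrightarrow> F t = 0"
proof -
  have "isCont f t" for t using assms(1) by (rule DERIV_isCont)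
  then have "\<exists>F. \<forall>t::real. - \<infinity> < ereal t \<longrightarrow> ereal t < \<infinity> \<longrightarrow> (F has_vector_derivative f t) (at t)"
    by (intro einterval_antiderivative) simp_all
  then obtain F0 where "\<And>t::real. (F0 has_vector_derivative f t) (at t)"
    by auto
  then have F0: "(F0 has_real_derivative f t) (at t)" for t
    by (simp add: has_real_derivative_iff_has_vector_derivative)
  have eq: "F0 t = F0 0" if "t \<le> 0" for t
  proof (cases "t = 0")
    case False
    with that have "t < 0" by simp
    then obtain z where "z < 0" "F0 0 - F0 t = (0 - t) * f z"
      using MVT2[OF \<open>t < 0\<close> F0] by blast
    then show ?thesis using assms(2)[of z] by simp
  qed simp
  have deriv: "((\<lambda>t. F0 t - F0 0) has_real_derivative f t) (at t)" for t
    by (rule DERIV_cong[OF DERIV_diff[OF F0 DERIV_const]]) simp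
  show thesis
  proof (rule that[OF deriv])
    show "F0 t - F0 0 = 0" if "t \<le> 0" for t using eq[OF that] by simp
  qed
qed

lemma poly_antiderivative:
  fixes Q :: "real poly"
  obtains P where "pderiv P = Q" "degree P \<le> Suc (degree Q)"
proof
  let ?P = "\<Sum>i\<le>degree Q. monom (coeff Q i / real (Suc i)) (Suc i)"
  have "pderiv ?P = (\<Sum>i\<le>degree Q. monom (coeff Q i) i)"
    by (simp add: higher_pderiv_sum[of 1, simplified] pderiv_monom del: of_nat_Suc)
  then show "pderiv ?P = Q" by (simp add: poly_as_sum_of_monoms)
  show "degree ?P \<le> Suc (degree Q)"
    by (intro degree_sum_le) (auto intro: order_trans[OF degree_monom_le])
qed

lemma eq_if_same_derivative_from:
  fixes F G :: "real \<Rightarrow> real"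
  assumes "\<And>t. (F has_real_derivative f t) (at t)" "\<And>t. (G has_real_derivative g t) (at t)"
    and "\<And>t. a \<le> t \<Longrightarrow> f t = g t" and "F a = G a" and "a \<le> t"
  shows "F t = G t"
proof (cases "a = t")
  case False
  with \<open>a \<le> t\<close> have "a < t" by simp
  then obtain z where "a < z" "(F t - G t) - (F a - G a) = (t - a) * (f z - g z)"
    using MVT2[OF \<open>a < t\<close> DERIV_diff[OF assms(1,2)]] by blast
  then show ?thesis using assms(3)[of z] assms(4) by simp
qed (use assms in simp)

text \<open>
\<open>X 0\<close> is the \<open>p\<close>-fold antiderivative of the bump \<open>X p\<close> that vanishes on the left. It is a smooth
version of the truncated power \<open>t\<^sub>+\<^sup>p\<^sup>-\<^sup>1 / (p - 1)!\<close>, the building block of splines: to the right of the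
bump it is a polynomial of degree less than \<open>p\<close>, because its \<open>p\<close>-th derivative is zero there.
Both the growth bound and the polynomial tail survive one more integration.
\<close>

lemma bump_iterated_antiderivative:
  assumes "1 \<le> p"
  obtains X :: "nat \<Rightarrow> real \<Rightarrow> real" and Q :: "real poly" where
    "\<And>k t. (X k has_real_derivative X (Suc k) t) (at t)"
    "\<And>t. 0 \<le> X p t" "\<And>t. t \<le> 0 \<or> 1 \<le> t \<Longrightarrow> X p t = 0" "(X p has_integral 1) {0..1}"
    "\<And>t. t \<le> 0 \<Longrightarrow> X 0 t = 0" "\<And>t. 0 \<le> t \<Longrightarrow> 0 \<le> X 0 t \<and> X 0 t \<le> t ^ (p - 1)"
    "degree Q < p" "\<And>t. 1 \<le> t \<Longrightarrow> X 0 t = poly Q t"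
proof -
  let ?P = "\<lambda>p X (Q::real poly). (\<forall>k t. (X k has_real_derivative X (Suc k) t) (at t)) \<and>
    (\<forall>t. 0 \<le> X p t) \<and> (\<forall>t. t \<le> 0 \<or> 1 \<le> t \<longrightarrow> X p t = 0) \<and> (X p has_integral (1::real)) {0..1} \<and>
    (\<forall>t\<le>0. X 0 t = 0) \<and> (\<forall>t\<ge>0. 0 \<le> X 0 t \<and> X 0 t \<le> t ^ (p - 1)) \<and>
    degree Q < p \<and> (\<forall>t\<ge>1. X 0 t = poly Q t)"
  have "\<exists>X Q. ?P p X Q" using assms
  proof (induction p rule: nat_induct_at_least)
    case base
    obtain B :: "nat \<Rightarrow> real \<Rightarrow> real" where
      B: "\<And>k t. (B k has_real_derivative B (Suc k) t) (at t)"
        "\<And>t. 0 \<le> B 0 t" "\<And>t. t \<le> 0 \<or> 1 \<le> t \<Longrightarrow> B 0 t = 0" "(B 0 has_integral 1) {0..1}"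
      by (rule smooth_bump) (rule that)
    obtain F where F: "\<And>t. (F has_real_derivative B 0 t) (at t)" "\<And>t. t \<le> 0 \<Longrightarrow> F t = 0"
      by (rule antiderivative_vanishing_on_nonpos[OF B(1)]) (use B(3) in auto)
    have "(B 0 has_integral F 1 - F 0) {0..1}"
    proof (rule fundamental_theorem_of_calculus)
      show "(F has_vector_derivative B 0 t) (at t within {0..1})" for t
        using has_field_derivative_at_within[OF F(1)]
        by (simp add: has_real_derivative_iff_has_vector_derivative)
    qed simp
    from has_integral_unique[OF this B(4)] have "F 1 = 1" using F(2)[of 0] by simp
    then have F1: "F t = 1" if "1 \<le> t" for t
      using eq_if_same_derivative_from[OF F(1) DERIV_const[of 1], of 1 t] B(3) that by simp
    have mono: "F s \<le> F t" if "s \<le> t" for s t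
      by (rule DERIV_nonneg_imp_nondecreasing[OF that]) (meson F(1) B(2))
    have "F t \<le> 1" for t
      using mono[of t "max t 1"] F1[of "max t 1"] by simp
    moreover have "0 \<le> F t" if "0 \<le> t" for t
      using mono[OF that] F(2)[of 0] by simp
    moreover have "(case_nat F B k has_real_derivative case_nat F B (Suc k) t) (at t)" for k t
      by (cases k) (simp_all add: F(1) B(1))
    ultimately have "?P 1 (case_nat F B) [:1:]"
      using B(2-4) F(2) F1 by simp
    then show ?case by (intro exI)
  next
    case (Suc p)
    from Suc.IH obtain X Q where X: "?P p X Q" by (elim exE)
    then have X0: "\<And>t. (X 0 has_real_derivative X (Suc 0) t) (at t)" "\<And>t. t \<le> 0 \<Longrightarrow> X 0 t = 0"
      by auto
    obtain F where F: "\<And>t. (F has_real_derivative X 0 t) (at t)" "\<And>t. t \<le> 0 \<Longrightarrow> F t = 0"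
      by (rule antiderivative_vanishing_on_nonpos[OF X0]) auto
    have bound: "0 \<le> F t \<and> F t \<le> t ^ p" if "0 \<le> t" for t
    proof (cases "t = 0")
      case False
      with that have "0 < t" by simp
      then obtain z where z: "0 < z" "z < t" "F t - F 0 = (t - 0) * X 0 z"
        using MVT2[OF \<open>0 < t\<close> F(1)] by blast
      have "0 \<le> X 0 z" "X 0 z \<le> z ^ (p - 1)" using X z by auto
      moreover have "z ^ (p - 1) \<le> t ^ (p - 1)" using z by (intro power_mono) auto
      ultimately have "0 \<le> t * X 0 z" "t * X 0 z \<le> t * t ^ (p - 1)"
        using that by (auto intro!: mult_left_mono)
      then show ?thesis using z(3) F(2)[of 0] \<open>1 \<le> p\<close> by (simp add: power_eq_if)
    qed (use F(2)[of 0] in auto)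
    obtain P where P: "pderiv P = Q" "degree P \<le> Suc (degree Q)" by (rule poly_antiderivative)
    define P' where "P' = P + [:F 1 - poly P 1:]"
    have "degree P' \<le> max (degree P) 0"
      unfolding P'_def by (rule degree_add_le_max[THEN order_trans]) simp
    then have "degree P' < Suc p" using P(2) X by simp
    moreover have "F t = poly P' t" if "1 \<le> t" for t
    proof (rule eq_if_same_derivative_from[OF F(1) poly_DERIV, of 1])
      show "X 0 s = poly (pderiv P') s" if "1 \<le> s" for s
        using that X P(1) by (simp add: P'_def pderiv_add pderiv_pCons)
    qed (use that in \<open>simp_all add: P'_def\<close>)
    moreover have "(case_nat F X k has_real_derivative case_nat F X (Suc k) t) (at t)" for k t
      using F(1) X by (cases k) simp_all
    ultimately have "?P (Suc p) (case_nat F X) P'"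
      using X F(2) bound by simp
    then show ?case by (intro exI)
  qed
  then obtain X Q where X: "?P p X Q" by (elim exE)
  show thesis by (rule that[of X Q]) (use X in auto)
qed

section \<open>Lagrange interpolation\<close>

definition lagrange_basis :: "('i \<Rightarrow> real) \<Rightarrow> 'i set \<Rightarrow> 'i \<Rightarrow> real \<Rightarrow> real" where
  "lagrange_basis x K k u = (\<Prod>i\<in>K - {k}. (u - x i) / (x k - x i))"

lemma lagrange_basis_node:
  assumes "finite K" "inj_on x K" "k \<in> K" "j \<in> K"
  shows "lagrange_basis x K k (x j) = (if j = k then 1 else 0)"
proof (cases "j = k")
  case True
  have "lagrange_basis x K k (x k) = (\<Prod>i\<in>K - {k}. 1)"
    unfolding lagrange_basis_def using assms by (intro prod.cong) (auto dest: inj_onD)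
  then show ?thesis using True by simp
next
  case False
  then have "j \<in> K - {k}" using assms by simp
  then have "lagrange_basis x K k (x j) = 0"
    unfolding lagrange_basis_def using assms(1) by (intro prod_zero) (auto intro!: bexI[of _ j])
  then show ?thesis using False by simp
qed

lemma lagrange_basis_poly:
  assumes "finite K" "k \<in> K"
  obtains P where "\<And>u. poly P u = lagrange_basis x K k u" "degree P < card K"
proof
  let ?P = "\<Prod>i\<in>K - {k}. Polynomial.smult (1 / (x k - x i)) [:- x i, 1:]"
  show "poly ?P u = lagrange_basis x K k u" for u
    unfolding lagrange_basis_def poly_prod by (intro prod.cong) (auto simp: diff_divide_distrib)
  have "degree ?P \<le> (\<Sum>i\<in>K - {k}. degree (Polynomial.smult (1 / (x k - x i)) [:- x i, 1:]))"
    by (rule degree_prod_sum_le[unfolded o_def]) (use assms in simp)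
  also have "\<dots> \<le> (\<Sum>i\<in>K - {k}. 1)"
    by (intro sum_mono) simp
  also have "\<dots> < card K"
    using assms card_gt_0_iff[of K] by auto
  finally show "degree ?P < card K" .
qed

text \<open>
Both sides are polynomials of degree less than the number of nodes and agree at every node.
\<close>

lemma lagrange_interpolation_exact:
  fixes q :: "real poly"
  assumes "finite K" "inj_on x K" "degree q < card K"
  shows "(\<Sum>k\<in>K. lagrange_basis x K k u * poly q (x k)) = poly q u"
proof -
  have "\<exists>P. \<forall>k\<in>K. (\<forall>u. poly (P k) u = lagrange_basis x K k u) \<and> degree (P k) < card K"
    by (intro bchoice ballI) (meson lagrange_basis_poly assms(1))
  then obtain P where P: "\<And>k u. k \<in> K \<Longrightarrow> poly (P k) u = lagrange_basis x K k u"
    "\<And>k. k \<in> K \<Longrightarrow> degree (P k) < card K" by auto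
  define R where "R = (\<Sum>k\<in>K. Polynomial.smult (poly q (x k)) (P k))"
  have R: "poly R u = (\<Sum>k\<in>K. lagrange_basis x K k u * poly q (x k))" for u
    unfolding R_def poly_sum by (intro sum.cong) (simp_all add: P(1))
  have RQ: "R = q"
  proof (rule poly_eqI_degree[of "x ` K"])
    have "degree (Polynomial.smult (poly q (x k)) (P k)) \<le> card K - 1" if "k \<in> K" for k
      using P(2)[OF that] degree_smult_le[of "poly q (x k)" "P k"] by linarith
    then have "degree R \<le> card K - 1"
      unfolding R_def by (intro degree_sum_le assms)
    then show "degree R < card (x ` K)" "degree q < card (x ` K)"
      using assms by (simp_all add: card_image)
    fix y assume "y \<in> x ` K"
    then obtain j where j: "j \<in> K" "y = x j" by auto
    have "poly R y = (\<Sum>k\<in>K. if k = j then poly q (x k) else 0)"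
      unfolding R j(2)
      by (intro sum.cong refl) (simp add: lagrange_basis_node[OF assms(1,2) _ j(1)])
    also have "\<dots> = poly q y"
      using assms(1) j(1) unfolding j(2) by (simp add: sum.delta')
    finally show "poly R y = poly q y" .
  qed
  show ?thesis unfolding R[symmetric] RQ ..
qed

lemma lagrange_basis_bound:
  assumes "finite K" "1 \<le> D" "\<And>i. i \<in> K \<Longrightarrow> \<bar>u - x i\<bar> \<le> D"
    and "\<And>i. i \<in> K \<Longrightarrow> i \<noteq> k \<Longrightarrow> 1 \<le> \<bar>x k - x i\<bar>"
  shows "\<bar>lagrange_basis x K k u\<bar> \<le> D ^ card K"
proof -
  have "\<bar>lagrange_basis x K k u\<bar> = (\<Prod>i\<in>K - {k}. \<bar>u - x i\<bar> / \<bar>x k - x i\<bar>)"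
    by (simp add: lagrange_basis_def abs_prod)
  also have "\<dots> \<le> (\<Prod>i\<in>K - {k}. D)"
  proof (intro prod_mono conjI)
    fix i assume i: "i \<in> K - {k}"
    have "\<bar>u - x i\<bar> / \<bar>x k - x i\<bar> \<le> \<bar>u - x i\<bar> / 1"
      using assms(4)[of i] i by (intro divide_left_mono) auto
    then show "\<bar>u - x i\<bar> / \<bar>x k - x i\<bar> \<le> D" using assms(3)[of i] i by simp
  qed simp
  also have "\<dots> \<le> D ^ card K"
    using assms(1,2) by (simp add: power_increasing card_mono)
  finally show ?thesis .
qed

section \<open>Point functionals of functions with a weak derivative\<close>

lemma continuous_on_closure_integral:
  fixes f :: "real \<Rightarrow> real"
  assumes "continuous_on {a..b} f"
  shows "integrable (lebesgue_on {a<..<b}) f"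
    and "(LINT t|lebesgue_on {a<..<b}. f t) = integral {a..b} f"
proof -
  have "set_integrable lebesgue {a<..<b} f"
    using absolutely_integrable_continuous_real[OF assms]
    by (rule set_integrable_subset) auto
  then show int: "integrable (lebesgue_on {a<..<b}) f"
    by (simp add: integrable_restrict_space set_integrable_def)
  show "(LINT t|lebesgue_on {a<..<b}. f t) = integral {a..b} f"
    using lebesgue_integral_eq_integral[OF int] by (simp add: integral_open_interval_real)
qed

text \<open>
The rescaled kernel is nonnegative, has integral \<open>1\<close> and lives on \<open>[\<sigma>, \<sigma> + \<epsilon>]\<close>, so integrating
against it averages values of \<open>g\<close> that all lie within \<open>\<delta>\<close> of \<open>y\<close>.
\<close>

lemma approximate_identity:
  fixes g k :: "real \<Rightarrow> real"
  assumes g: "continuous_on {a..b} g" and k: "continuous_on UNIV k"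
    and k0: "\<And>t. 0 \<le> k t" "\<And>t. t \<le> 0 \<or> 1 \<le> t \<Longrightarrow> k t = 0" and k1: "(k has_integral 1) {0..1}"
    and "0 < \<epsilon>" "a \<le> \<sigma>" "\<sigma> + \<epsilon> \<le> b"
    and near: "\<And>t. t \<in> {\<sigma>..\<sigma> + \<epsilon>} \<Longrightarrow> \<bar>g t - y\<bar> \<le> \<delta>"
  shows "\<bar>(LINT t|lebesgue_on {a<..<b}. g t * (k ((t - \<sigma>) / \<epsilon>) / \<epsilon>)) - y\<bar> \<le> \<delta>"
proof -
  let ?k = "\<lambda>t. k ((t - \<sigma>) / \<epsilon>) / \<epsilon>"
  have ck: "continuous_on {a..b} ?k"
    using \<open>0 < \<epsilon>\<close> by (intro continuous_intros continuous_on_compose2[OF k]) auto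
  have k_out: "?k t = 0" if "t \<notin> {\<sigma>..\<sigma> + \<epsilon>}" for t
  proof -
    have "(t - \<sigma>) / \<epsilon> \<le> 0 \<or> 1 \<le> (t - \<sigma>) / \<epsilon>"
      using that \<open>0 < \<epsilon>\<close> by (auto simp: field_simps)
    from k0(2)[OF this] show ?thesis by simp
  qed
  have "((\<lambda>t. k ((1 / \<epsilon>) *\<^sub>R t + (- \<sigma> / \<epsilon>))) has_integral 1 /\<^sub>R (1 / \<epsilon>) ^ DIM(real))
      (cbox ((0 - (- \<sigma> / \<epsilon>)) /\<^sub>R (1 / \<epsilon>)) ((1 - (- \<sigma> / \<epsilon>)) /\<^sub>R (1 / \<epsilon>)))"
    using k1 \<open>0 < \<epsilon>\<close> by (intro has_integral_affinity') auto
  moreover have "(1 - (- \<sigma> / \<epsilon>)) /\<^sub>R (1 / \<epsilon>) = \<sigma> + \<epsilon>" "(0 - (- \<sigma> / \<epsilon>)) /\<^sub>R (1 / \<epsilon>) = \<sigma>"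
    "1 /\<^sub>R (1 / \<epsilon>) ^ DIM(real) = \<epsilon>" "\<And>t. (1 / \<epsilon>) *\<^sub>R t + (- \<sigma> / \<epsilon>) = (t - \<sigma>) / \<epsilon>"
    using \<open>0 < \<epsilon>\<close> by (simp_all add: field_simps)
  ultimately have "((\<lambda>t. k ((t - \<sigma>) / \<epsilon>)) has_integral \<epsilon>) {\<sigma>..\<sigma> + \<epsilon>}"
    by simp
  from has_integral_divide[OF this, of \<epsilon>] have "(?k has_integral 1) {\<sigma>..\<sigma> + \<epsilon>}"
    using \<open>0 < \<epsilon>\<close> by simp
  then have int: "(?k has_integral 1) {a..b}"
    by (rule has_integral_on_superset) (use k_out assms in auto)
  have gk: "continuous_on {a..b} (\<lambda>t. g t * ?k t)"
    by (intro continuous_intros g ck)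
  have "(LINT t|lebesgue_on {a<..<b}. g t * ?k t) - y = integral {a..b} (\<lambda>t. g t * ?k t) - integral {a..b} (\<lambda>t. y * ?k t)"
    unfolding continuous_on_closure_integral(2)[OF gk]
    using integral_unique[OF has_integral_mult_right[OF int, of y]] by simp
  also have "\<dots> = integral {a..b} (\<lambda>t. g t * ?k t - y * ?k t)"
    by (intro integral_diff[symmetric] integrable_continuous_real gk continuous_intros ck)
  also have "norm \<dots> \<le> integral {a..b} (\<lambda>t. \<delta> * ?k t)"
  proof (rule integral_norm_bound_integral)
    show "(\<lambda>t. g t * ?k t - y * ?k t) integrable_on {a..b}" "(\<lambda>t. \<delta> * ?k t) integrable_on {a..b}"
      by (intro integrable_continuous_real continuous_intros gk ck)+
    fix t
    show "norm (g t * ?k t - y * ?k t) \<le> \<delta> * ?k t"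
    proof (cases "t \<in> {\<sigma>..\<sigma> + \<epsilon>}")
      case True
      have "norm (g t * ?k t - y * ?k t) = \<bar>g t - y\<bar> * ?k t"
        using k0(1) \<open>0 < \<epsilon>\<close>
        by (simp only: left_diff_distrib[symmetric] real_norm_def abs_mult) simp
      also have "\<dots> \<le> \<delta> * ?k t"
        using near[OF True] k0(1) \<open>0 < \<epsilon>\<close> by (intro mult_right_mono) auto
      finally show ?thesis .
    next
      case False
      show ?thesis unfolding k_out[OF False] by simp
    qed
  qed
  also have "\<dots> = \<delta>"
    using integral_unique[OF has_integral_mult_right[OF int, of \<delta>]] by simp
  finally show ?thesis by simp
qed

lemma higher_deriv_eq_sequence:
  fixes Y :: "nat \<Rightarrow> real \<Rightarrow> real"
  assumes "\<And>k t. (Y k has_real_derivative Y (Suc k) t) (at t)"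
  shows "(deriv ^^ k) (Y 0) = Y k"
proof (induction k)
  case (Suc k)
  have "deriv (Y k) = Y (Suc k)"
    by (rule ext) (rule DERIV_imp_deriv[OF assms])
  then show ?case using Suc by simp
qed simp

lemma integrable_abs_times_indicator:
  fixes w :: "real \<Rightarrow> real"
  assumes "integrable (lebesgue_on S) w"
  shows "integrable (lebesgue_on S) (\<lambda>t. \<bar>w t\<bar> * indicator {\<alpha>..\<beta>} t)"
proof (rule Bochner_Integration.integrable_bound[OF integrable_abs[OF assms]])
  have "indicator {\<alpha>..\<beta>} \<in> borel_measurable (lebesgue_on S)"
    by (intro measurable_restrict_space1 borel_measurable_indicator) simp
  then show "(\<lambda>t. \<bar>w t\<bar> * indicator {\<alpha>..\<beta>} t) \<in> borel_measurable (lebesgue_on S)"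
    using assms by (intro borel_measurable_times borel_measurable_abs) auto
qed (auto simp: indicator_def)

text \<open>
The test function is \<open>\<phi> t = (\<Sum>i\<in>I. c i * \<epsilon>\<^sup>p\<^sup>-\<^sup>1 * X 0 ((t - s i) / \<epsilon>))\<close>, a smoothed B-spline. Left of all
\<open>s i\<close> every summand is zero. Right of all of them every summand is a polynomial of degree less than
\<open>p\<close> in \<open>s i\<close>, so the sum is zero because the functional annihilates such polynomials; this gives
\<open>\<phi>\<close> compact support. Its \<open>p\<close>-th derivative is the combination of narrow bumps at the \<open>s i\<close>, and
moving the derivatives onto \<open>g\<close> leaves \<open>\<integral> w \<phi>\<close>, where \<open>\<phi>\<close> is bounded uniformly in \<open>\<epsilon>\<close>.
\<close>

lemma smoothed_functional_bound:
  fixes g w :: "real \<Rightarrow> real" and c s :: "'i \<Rightarrow> real" and X :: "nat \<Rightarrow> real \<Rightarrow> real"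
  assumes "1 \<le> p"
    and X: "\<And>k t. (X k has_real_derivative X (Suc k) t) (at t)"
    and X0: "\<And>t. t \<le> 0 \<Longrightarrow> X 0 t = 0" "\<And>t. 0 \<le> t \<Longrightarrow> 0 \<le> X 0 t \<and> X 0 t \<le> t ^ (p - 1)"
    and Q: "degree Q < p" "\<And>t. 1 \<le> t \<Longrightarrow> X 0 t = poly Q t"
    and le: "a \<le> \<alpha>" "\<beta> \<le> b" and "0 < \<mu>" "0 < \<epsilon>" and "finite I"
    and s: "\<And>i. i \<in> I \<Longrightarrow> \<alpha> + \<mu> \<le> s i \<and> s i + \<epsilon> \<le> \<beta> - \<mu>"
    and annihilates: "\<And>q :: real poly. degree q < p \<Longrightarrow> (\<Sum>i\<in>I. c i * poly q (s i)) = 0"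
    and g: "continuous_on {a..b} g"
    and w: "weak_derivative a b p g w" "integrable (lebesgue_on {a<..<b}) w"
  shows "\<bar>\<Sum>i\<in>I. c i * (LINT t|lebesgue_on {a<..<b}. g t * (X p ((t - s i) / \<epsilon>) / \<epsilon>))\<bar>
    \<le> (\<Sum>i\<in>I. \<bar>c i\<bar>) * (\<beta> - \<alpha>) ^ (p - 1) * (LINT t|lebesgue_on {a<..<b}. \<bar>w t\<bar> * indicator {\<alpha>..\<beta>} t)"
proof -
  define Y where "Y k t = (\<Sum>i\<in>I. c i * \<epsilon> ^ (p - 1) / \<epsilon> ^ k * X k ((t - s i) / \<epsilon>))" for k t
  let ?K = "(\<Sum>i\<in>I. \<bar>c i\<bar>) * (\<beta> - \<alpha>) ^ (p - 1)"
  let ?M = "lebesgue_on {a<..<b}"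
  have scaled: "((\<lambda>t. X k ((t - \<sigma>) / \<epsilon>)) has_real_derivative X (Suc k) ((t - \<sigma>) / \<epsilon>) * (1 / \<epsilon>)) (at t)" for k t \<sigma>
    by (rule DERIV_chain2[where g = "\<lambda>t. (t - \<sigma>) / \<epsilon>", OF X])
      (use \<open>0 < \<epsilon>\<close> in \<open>auto intro!: derivative_eq_intros\<close>)
  have Y: "(Y k has_real_derivative Y (Suc k) t) (at t)" for k t
  proof -
    have "((\<lambda>t. \<Sum>i\<in>I. c i * \<epsilon> ^ (p - 1) / \<epsilon> ^ k * X k ((t - s i) / \<epsilon>)) has_real_derivative
       (\<Sum>i\<in>I. c i * \<epsilon> ^ (p - 1) / \<epsilon> ^ k * (X (Suc k) ((t - s i) / \<epsilon>) * (1 / \<epsilon>)))) (at t)"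
      by (intro DERIV_sum DERIV_cmult scaled)
    then show ?thesis
      unfolding Y_def by (rule DERIV_cong) (intro sum.cong, simp_all)
  qed
  have out0: "Y 0 t = 0" if "t \<notin> {\<alpha> + \<mu>..\<beta> - \<mu>}" for t
  proof (cases "t < \<alpha> + \<mu>")
    case True
    have "X 0 ((t - s i) / \<epsilon>) = 0" if "i \<in> I" for i
      using s[OF that] True \<open>0 < \<epsilon>\<close> by (intro X0) (auto simp: divide_le_0_iff)
    then show ?thesis by (simp add: Y_def)
  next
    case False
    with that have t: "\<beta> - \<mu> < t" by simp
    \<comment> \<open>As a function of the point, with the time \<open>t\<close> fixed, the tail is again a polynomial.\<close>
    let ?q = "pcompose Q [:t / \<epsilon>, - 1 / \<epsilon>:]"
    have "X 0 ((t - s i) / \<epsilon>) = poly ?q (s i)" if "i \<in> I" for i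
    proof -
      have "1 \<le> (t - s i) / \<epsilon>" using s[OF that] t \<open>0 < \<epsilon>\<close> by (simp add: field_simps)
      then show ?thesis by (simp add: Q(2) poly_pcompose diff_divide_distrib)
    qed
    then have "Y 0 t = \<epsilon> ^ (p - 1) * (\<Sum>i\<in>I. c i * poly ?q (s i))"
      unfolding Y_def sum_distrib_left by (intro sum.cong) (simp_all add: mult_ac)
    moreover have "degree ?q < p"
      using Q(1) degree_pcompose_le[of Q "[:t / \<epsilon>, - 1 / \<epsilon>:]"]
      by (auto split: if_splits)
    ultimately show ?thesis by (simp add: annihilates)
  qed
  have "{t. Y 0 t \<noteq> 0} \<subseteq> {\<alpha> + \<mu>..\<beta> - \<mu>}"
    using out0 by blast
  then have "closure {t. Y 0 t \<noteq> 0} \<subseteq> {\<alpha> + \<mu>..\<beta> - \<mu>}"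
    by (rule closure_minimal) simp
  also have "\<dots> \<subseteq> {a<..<b}"
    using le \<open>0 < \<mu>\<close> by auto
  finally have supp: "closure {t. Y 0 t \<noteq> 0} \<subseteq> {a<..<b}" .
  have out: "Y 0 t = 0" if "t \<notin> {\<alpha>..\<beta>}" for t
    by (rule out0) (use that \<open>0 < \<mu>\<close> in auto)
  have higher: "(deriv ^^ k) (Y 0) = Y k" for k
    by (rule higher_deriv_eq_sequence) (rule Y)
  have test: "test_function a b (Y 0)"
    unfolding test_function_def higher using supp Y
    by (auto simp: field_differentiable_def)
  have bound: "\<bar>Y 0 t\<bar> \<le> ?K * indicator {\<alpha>..\<beta>} t" for t
  proof (cases "t \<in> {\<alpha>..\<beta>}")
    case True
    have "\<bar>\<epsilon> ^ (p - 1) * X 0 ((t - s i) / \<epsilon>)\<bar> \<le> (\<beta> - \<alpha>) ^ (p - 1)" if i: "i \<in> I" for i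
    proof (cases "s i \<le> t")
      case True
      with \<open>0 < \<epsilon>\<close> have "0 \<le> (t - s i) / \<epsilon>" by simp
      from X0(2)[OF this] have "\<bar>\<epsilon> ^ (p - 1) * X 0 ((t - s i) / \<epsilon>)\<bar> \<le> \<epsilon> ^ (p - 1) * ((t - s i) / \<epsilon>) ^ (p - 1)"
        using \<open>0 < \<epsilon>\<close> by (simp add: abs_mult)
      also have "\<dots> = (t - s i) ^ (p - 1)"
        using \<open>0 < \<epsilon>\<close> by (simp add: power_divide)
      also have "\<dots> \<le> (\<beta> - \<alpha>) ^ (p - 1)"
        using s[OF i] True \<open>t \<in> _\<close> \<open>0 < \<mu>\<close> by (intro power_mono) auto
      finally show ?thesis .
    next
      case False
      then have "(t - s i) / \<epsilon> \<le> 0" using \<open>0 < \<epsilon>\<close> by (simp add: divide_le_0_iff)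
      then show ?thesis using X0(1) True by simp
    qed
    then have "\<bar>c i\<bar> * \<bar>\<epsilon> ^ (p - 1) * X 0 ((t - s i) / \<epsilon>)\<bar> \<le> \<bar>c i\<bar> * (\<beta> - \<alpha>) ^ (p - 1)" if "i \<in> I" for i
      using that by (intro mult_left_mono) auto
    then have "(\<Sum>i\<in>I. \<bar>c i * \<epsilon> ^ (p - 1) / \<epsilon> ^ 0 * X 0 ((t - s i) / \<epsilon>)\<bar>) \<le> (\<Sum>i\<in>I. \<bar>c i\<bar> * (\<beta> - \<alpha>) ^ (p - 1))"
      by (intro sum_mono) (simp add: abs_mult mult.assoc)
    then show ?thesis
      unfolding Y_def using True by (auto simp: sum_distrib_right intro: order_trans[OF sum_abs])
  qed (simp add: out)
  have kernel: "continuous_on {a..b} (\<lambda>t. g t * (X p ((t - s i) / \<epsilon>) / \<epsilon>))" for i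
    using \<open>0 < \<epsilon>\<close> DERIV_isCont[OF scaled[of p "s i"]]
    by (intro continuous_intros g continuous_at_imp_continuous_on) auto
  have "\<epsilon> ^ (p - 1) / \<epsilon> ^ p = 1 / \<epsilon>"
    using \<open>1 \<le> p\<close> \<open>0 < \<epsilon>\<close> by (cases p) (auto simp: field_simps)
  then have Yp: "Y p t = (\<Sum>i\<in>I. c i * (X p ((t - s i) / \<epsilon>) / \<epsilon>))" for t
    unfolding Y_def by (intro sum.cong refl) (simp add: times_divide_eq_right[symmetric] del: times_divide_eq_right)
  have "(\<Sum>i\<in>I. c i * (LINT t|?M. g t * (X p ((t - s i) / \<epsilon>) / \<epsilon>)))
      = (LINT t|?M. (\<Sum>i\<in>I. c i * (g t * (X p ((t - s i) / \<epsilon>) / \<epsilon>))))"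
  proof -
    have "integrable ?M (\<lambda>t. c i * (g t * (X p ((t - s i) / \<epsilon>) / \<epsilon>)))" for i
      by (intro integrable_mult_right continuous_on_closure_integral(1) kernel)
    then show ?thesis
      by (subst Bochner_Integration.integral_sum) (simp_all only: integral_mult_right_zero)
  qed
  also have "\<dots> = (LINT t|?M. g t * Y p t)"
    unfolding Yp by (intro Bochner_Integration.integral_cong refl) (simp add: sum_distrib_left mult_ac)
  also have "\<dots> = (- 1) ^ p * (LINT t|?M. w t * Y 0 t)"
    using w(1) test unfolding weak_derivative_def by (metis higher)
  also have "\<bar>\<dots>\<bar> = \<bar>LINT t|?M. w t * Y 0 t\<bar>"
    by (simp add: abs_mult power_abs)
  also have "\<dots> \<le> (LINT t|?M. \<bar>w t * Y 0 t\<bar>)"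
    by (rule integral_abs_bound)
  also have "\<dots> \<le> (LINT t|?M. ?K * (\<bar>w t\<bar> * indicator {\<alpha>..\<beta>} t))"
  proof (rule integral_mono')
    show "integrable ?M (\<lambda>t. ?K * (\<bar>w t\<bar> * indicator {\<alpha>..\<beta>} t))"
      by (intro integrable_mult_right integrable_abs_times_indicator w)
    fix t
    have "\<bar>w t * Y 0 t\<bar> \<le> \<bar>w t\<bar> * (?K * indicator {\<alpha>..\<beta>} t)"
      unfolding abs_mult by (intro mult_left_mono bound) simp
    then show le: "\<bar>w t * Y 0 t\<bar> \<le> ?K * (\<bar>w t\<bar> * indicator {\<alpha>..\<beta>} t)"
      by (simp only: mult_ac)
    show "0 \<le> ?K * (\<bar>w t\<bar> * indicator {\<alpha>..\<beta>} t)"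
      using le abs_ge_zero order_trans by blast
  qed
  finally show ?thesis by simp
qed

text \<open>
A Peano kernel estimate for weak derivatives. It is the limit \<open>\<epsilon> \<rightarrow> 0\<close> of the preceding bound, in
which the bumps concentrate at the points. Points at the ends of the interval are not admissible
there, so all points are first contracted slightly towards the midpoint; an affine map preserves
the degree of polynomials, hence the annihilation property, and continuity of \<open>g\<close> pays for the
displacement.
\<close>

lemma weak_derivative_functional_bound:
  fixes g w :: "real \<Rightarrow> real" and c s :: "'i \<Rightarrow> real"
  assumes "1 \<le> p" and le: "a \<le> \<alpha>" "\<alpha> < \<beta>" "\<beta> \<le> b" and "finite I"
    and s: "\<And>i. i \<in> I \<Longrightarrow> s i \<in> {\<alpha>..\<beta>}"
    and annihilates: "\<And>q :: real poly. degree q < p \<Longrightarrow> (\<Sum>i\<in>I. c i * poly q (s i)) = 0"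
    and g: "continuous_on {a..b} g"
    and w: "weak_derivative a b p g w" "integrable (lebesgue_on {a<..<b}) w"
  shows "\<bar>\<Sum>i\<in>I. c i * g (s i)\<bar>
    \<le> (\<Sum>i\<in>I. \<bar>c i\<bar>) * (\<beta> - \<alpha>) ^ (p - 1) * (LINT t|lebesgue_on {a<..<b}. \<bar>w t\<bar> * indicator {\<alpha>..\<beta>} t)"
    (is "_ \<le> ?R")
proof (rule field_le_epsilon)
  fix \<delta> :: real assume "0 < \<delta>"
  obtain X :: "nat \<Rightarrow> real \<Rightarrow> real" and Q :: "real poly" where
    X: "\<And>k t. (X k has_real_derivative X (Suc k) t) (at t)"
      "\<And>t. 0 \<le> X p t" "\<And>t. t \<le> 0 \<or> 1 \<le> t \<Longrightarrow> X p t = 0" "(X p has_integral 1) {0..1}"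
      "\<And>t. t \<le> 0 \<Longrightarrow> X 0 t = 0" "\<And>t. 0 \<le> t \<Longrightarrow> 0 \<le> X 0 t \<and> X 0 t \<le> t ^ (p - 1)"
      "degree Q < p" "\<And>t. 1 \<le> t \<Longrightarrow> X 0 t = poly Q t"
    by (rule bump_iterated_antiderivative[OF \<open>1 \<le> p\<close>]) (rule that)
  have contX: "continuous_on UNIV (X p)"
    using DERIV_isCont[OF X(1)] by (intro continuous_at_imp_continuous_on) auto
  define \<delta>' where "\<delta>' = \<delta> / (1 + (\<Sum>i\<in>I. \<bar>c i\<bar>))"
  have pos: "0 < 1 + (\<Sum>i\<in>I. \<bar>c i\<bar>)" by (rule add_pos_nonneg) (auto intro: sum_nonneg)
  then have "0 < \<delta>'" using \<open>0 < \<delta>\<close> by (simp add: \<delta>'_def)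
  have "uniformly_continuous_on {a..b} g"
    using g by (intro compact_uniformly_continuous) auto
  with \<open>0 < \<delta>'\<close> obtain \<eta> where "0 < \<eta>"
    and \<eta>: "\<And>t t'. t \<in> {a..b} \<Longrightarrow> t' \<in> {a..b} \<Longrightarrow> \<bar>t' - t\<bar> < \<eta> \<Longrightarrow> \<bar>g t' - g t\<bar> < \<delta>'"
    unfolding uniformly_continuous_on_def dist_real_def by metis
  define L where "L = \<beta> - \<alpha>"
  have "0 < L" using le by (simp add: L_def)
  define \<theta> where "\<theta> = min 1 (\<eta> / L)"
  have \<theta>: "0 < \<theta>" "\<theta> \<le> 1" "\<theta> * L \<le> \<eta>"
    using \<open>0 < \<eta>\<close> \<open>0 < L\<close> by (auto simp: \<theta>_def min_def field_simps)
  define s' where "s' i = (1 - \<theta>) * s i + \<theta> * ((\<alpha> + \<beta>) / 2)" for i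
  \<comment> \<open>The contraction frees a margin of \<open>2 \<epsilon>\<close> at each end: half of the margin takes the width of
    a bump, half keeps the support of the test function away from the end.\<close>
  define \<epsilon> where "\<epsilon> = \<theta> * L / 4"
  have "0 < \<epsilon>" using \<theta> \<open>0 < L\<close> by (simp add: \<epsilon>_def)
  have s': "\<alpha> + \<epsilon> \<le> s' i \<and> s' i + \<epsilon> \<le> \<beta> - \<epsilon>" "\<bar>s' i - s i\<bar> \<le> 2 * \<epsilon>" if "i \<in> I" for i
  proof -
    have "(1 - \<theta>) * \<alpha> \<le> (1 - \<theta>) * s i" "(1 - \<theta>) * s i \<le> (1 - \<theta>) * \<beta>"
      using s[OF that] \<theta> by (auto intro!: mult_left_mono)
    moreover have "(1 - \<theta>) * \<alpha> + \<theta> * ((\<alpha> + \<beta>) / 2) = \<alpha> + 2 * \<epsilon>"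
      "(1 - \<theta>) * \<beta> + \<theta> * ((\<alpha> + \<beta>) / 2) = \<beta> - 2 * \<epsilon>"
      by (simp_all add: \<epsilon>_def L_def field_simps)
    ultimately show "\<alpha> + \<epsilon> \<le> s' i \<and> s' i + \<epsilon> \<le> \<beta> - \<epsilon>"
      using \<open>0 < \<epsilon>\<close> by (simp add: s'_def)
    have "s' i - s i = \<theta> * ((\<alpha> + \<beta>) / 2 - s i)"
      by (simp add: s'_def field_simps)
    moreover have "\<bar>(\<alpha> + \<beta>) / 2 - s i\<bar> \<le> L / 2"
      using s[OF that] by (auto simp: L_def abs_if field_simps)
    ultimately show "\<bar>s' i - s i\<bar> \<le> 2 * \<epsilon>"
      using \<theta>(1) mult_left_mono[of "\<bar>(\<alpha> + \<beta>) / 2 - s i\<bar>" "L / 2" \<theta>] by (simp add: abs_mult \<epsilon>_def)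
  qed
  let ?G = "\<lambda>i. LINT t|lebesgue_on {a<..<b}. g t * (X p ((t - s' i) / \<epsilon>) / \<epsilon>)"
  have close: "\<bar>?G i - g (s i)\<bar> \<le> \<delta>'" if i: "i \<in> I" for i
  proof (rule approximate_identity[OF g contX X(2-4) \<open>0 < \<epsilon>\<close>])
    show "a \<le> s' i" "s' i + \<epsilon> \<le> b" using s'(1)[OF i] le \<open>0 < \<epsilon>\<close> by auto
    fix t assume t: "t \<in> {s' i..s' i + \<epsilon>}"
    have "4 * \<epsilon> \<le> \<eta>" using \<theta> by (simp add: \<epsilon>_def)
    then have "\<bar>t - s i\<bar> < \<eta>" using t s'(2)[OF i] \<open>0 < \<epsilon>\<close> by auto
    moreover have "t \<in> {a..b}" "s i \<in> {a..b}" using t s'(1)[OF i] s[OF i] le \<open>0 < \<epsilon>\<close> by auto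
    ultimately show "\<bar>g t - g (s i)\<bar> \<le> \<delta>'" using \<eta> by (meson less_imp_le)
  qed
  have "\<bar>\<Sum>i\<in>I. c i * ?G i\<bar> \<le> ?R"
  proof (rule smoothed_functional_bound[OF \<open>1 \<le> p\<close> X(1) X(5,6,7,8) le(1,3) \<open>0 < \<epsilon>\<close> \<open>0 < \<epsilon>\<close> \<open>finite I\<close> s'(1) _ g w])
    fix q :: "real poly" assume q: "degree q < p"
    let ?q = "pcompose q [:\<theta> * ((\<alpha> + \<beta>) / 2), 1 - \<theta>:]"
    have "degree ?q < p"
      using q degree_pcompose_le[of q "[:\<theta> * ((\<alpha> + \<beta>) / 2), 1 - \<theta>:]"] by (auto split: if_splits)
    from annihilates[OF this] show "(\<Sum>i\<in>I. c i * poly q (s' i)) = 0"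
      by (simp add: poly_pcompose s'_def add.commute mult.commute)
  qed
  moreover have "\<bar>(\<Sum>i\<in>I. c i * g (s i)) - (\<Sum>i\<in>I. c i * ?G i)\<bar> \<le> (\<Sum>i\<in>I. \<bar>c i\<bar> * \<delta>')"
  proof -
    have "\<bar>(\<Sum>i\<in>I. c i * g (s i)) - (\<Sum>i\<in>I. c i * ?G i)\<bar> = \<bar>\<Sum>i\<in>I. c i * (g (s i) - ?G i)\<bar>"
      by (simp add: sum_subtractf right_diff_distrib)
    also have "\<dots> \<le> (\<Sum>i\<in>I. \<bar>c i * (g (s i) - ?G i)\<bar>)" by (rule sum_abs)
    also have "\<dots> \<le> (\<Sum>i\<in>I. \<bar>c i\<bar> * \<delta>')"
      unfolding abs_mult using close by (intro sum_mono mult_left_mono) (auto simp: abs_minus_commute)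
    finally show ?thesis .
  qed
  moreover have "(\<Sum>i\<in>I. \<bar>c i\<bar> * \<delta>') \<le> \<delta>"
  proof -
    have "(\<Sum>i\<in>I. \<bar>c i\<bar>) * \<delta>' \<le> (1 + (\<Sum>i\<in>I. \<bar>c i\<bar>)) * \<delta>'"
      using \<open>0 < \<delta>'\<close> by (intro mult_right_mono) auto
    also have "\<dots> = \<delta>" using pos by (simp add: \<delta>'_def)
    finally show ?thesis by (simp add: sum_distrib_right)
  qed
  ultimately show "\<bar>\<Sum>i\<in>I. c i * g (s i)\<bar> \<le> ?R + \<delta>" by linarith
qed

section \<open>Sampling inequality\<close>

lemma square_integrable_imp_integrable:
  assumes "square_integrable 0 T w"
  shows "integrable (lebesgue_on {0<..<T}) w"
proof (rule Bochner_Integration.integrable_bound)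
  show "integrable (lebesgue_on {0<..<T}) (\<lambda>t. 1 + (w t)\<^sup>2)"
    using assms continuous_on_closure_integral(1)[of 0 T "\<lambda>_. 1"]
    by (intro Bochner_Integration.integrable_add) (auto simp: square_integrable_def)
  show "w \<in> borel_measurable (lebesgue_on {0<..<T})"
    using assms by (simp add: square_integrable_def)
  have "\<bar>y\<bar> \<le> 1 + y\<^sup>2" for y :: real
  proof -
    have "0 \<le> (\<bar>y\<bar> - 1)\<^sup>2" by simp
    then have "2 * \<bar>y\<bar> \<le> 1 + y\<^sup>2" by (simp add: power2_diff)
    then show ?thesis by linarith
  qed
  then show "AE t in lebesgue_on {0<..<T}. norm (w t) \<le> norm (1 + (w t)\<^sup>2)"
    by simp
qed

text \<open>
Cauchy--Schwarz against the constant function, read off from the fact that the variance of \<open>\<bar>w\<bar>\<close>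
is nonnegative.
\<close>

lemma L1_le_L2_norm:
  assumes "0 < T" "square_integrable 0 T w"
  shows "(LINT t|lebesgue_on {0<..<T}. \<bar>w t\<bar>) \<le> sqrt T * L2_norm 0 T w"
proof -
  let ?M = "lebesgue_on {0<..<T}"
  define m where "m = (LINT t|?M. \<bar>w t\<bar>) / T"
  have abs: "integrable ?M (\<lambda>t. \<bar>w t\<bar>)"
    by (intro integrable_abs square_integrable_imp_integrable assms)
  have sq: "integrable ?M (\<lambda>t. (w t)\<^sup>2)"
    using assms(2) by (simp add: square_integrable_def)
  have const: "integrable ?M (\<lambda>t. c)" "(LINT t|?M. c) = c * T" for c :: real
    using continuous_on_closure_integral[of 0 T "\<lambda>_. c"] \<open>0 < T\<close> by auto
  have "0 \<le> (LINT t|?M. (\<bar>w t\<bar> - m)\<^sup>2)"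
    by (intro Bochner_Integration.integral_nonneg) simp
  also have "\<dots> = (LINT t|?M. (w t)\<^sup>2 - 2 * m * \<bar>w t\<bar> + m\<^sup>2)"
    by (intro Bochner_Integration.integral_cong refl) (simp add: power2_diff mult_ac)
  also have "\<dots> = (LINT t|?M. (w t)\<^sup>2) - 2 * m * (LINT t|?M. \<bar>w t\<bar>) + m\<^sup>2 * T"
    using abs sq const by simp
  also have "\<dots> = (LINT t|?M. (w t)\<^sup>2) - (LINT t|?M. \<bar>w t\<bar>)\<^sup>2 / T"
    using \<open>0 < T\<close> by (simp add: m_def field_simps power2_eq_square)
  finally have "(LINT t|?M. \<bar>w t\<bar>)\<^sup>2 \<le> T * (LINT t|?M. (w t)\<^sup>2)"
    using \<open>0 < T\<close> by (simp add: field_simps)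
  then show ?thesis
    unfolding L2_norm_def real_sqrt_mult[symmetric] by (rule real_le_rsqrt)
qed

lemma integral_uniform_partition:
  fixes f :: "real \<Rightarrow> real"
  assumes "0 \<le> h" "continuous_on {0..real N * h} f"
  shows "integral {0..real N * h} f = (\<Sum>n<N. integral {real n * h..real (Suc n) * h} f)"
  using assms(2)
proof (induction N)
  case (Suc N)
  have "integral {0..real (Suc N) * h} f
      = integral {0..real N * h} f + integral {real N * h..real (Suc N) * h} f"
    using Suc.prems \<open>0 \<le> h\<close>
    by (intro Henstock_Kurzweil_Integration.integral_combine[symmetric] integrable_continuous_real)
      (auto simp: mult_right_mono)
  moreover have "continuous_on {0..real N * h} f"
    by (rule continuous_on_subset[OF Suc.prems]) (use \<open>0 \<le> h\<close> in \<open>auto simp: algebra_simps\<close>)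
  ultimately show ?case using Suc.IH by simp
qed simp

text \<open>
The functional is the interpolation error at \<open>t\<close>: evaluation at \<open>t\<close> minus the Lagrange
interpolant through \<open>p\<close> consecutive grid points. It annihilates polynomials of degree less than
\<open>p\<close>, so the Peano kernel estimate bounds it by \<open>h\<^sup>p\<^sup>-\<^sup>1\<close> times the integral of \<open>\<bar>w\<bar>\<close> over the panel. The
grid point \<open>j + p\<close> itself is not a node and may lie beyond \<open>T\<close>; points \<open>t\<close> between the last node
and it are reached by extrapolation.
\<close>

lemma interpolation_panel_bound:
  fixes g w :: "real \<Rightarrow> real" and p j :: nat and h t :: real
  assumes "1 \<le> p" "0 < h" and t: "real j * h \<le> t" "t \<le> real (j + p) * h" "t \<le> T"
    and le: "real (j + p - 1) * h \<le> T" "real j * h < T"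
    and g: "continuous_on {0..T} g"
    and w: "weak_derivative 0 T p g w" "integrable (lebesgue_on {0<..<T}) w"
  shows "\<bar>g t\<bar> \<le> real p ^ p * (\<Sum>k<p. \<bar>g (real (j + k) * h)\<bar>)
    + (1 + real p * real p ^ p) * (real p * h) ^ (p - 1) *
      (LINT t|lebesgue_on {0<..<T}. \<bar>w t\<bar> * indicator {real j * h..real (j + p) * h} t)"
proof -
  define \<tau> where "\<tau> = t / h - real j"
  have \<tau>: "0 \<le> \<tau>" "\<tau> \<le> real p" using t \<open>0 < h\<close> by (simp_all add: \<tau>_def field_simps)
  define l where "l k = lagrange_basis real {..<p} k \<tau>" for k
  have l: "\<bar>l k\<bar> \<le> real p ^ p" for k
  proof -
    have "\<bar>l k\<bar> \<le> real p ^ card {..<p}"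
      unfolding l_def using \<open>1 \<le> p\<close> \<tau> by (intro lagrange_basis_bound) auto
    then show ?thesis by simp
  qed
  \<comment> \<open>Index \<open>p\<close> stands for the evaluation point, the smaller indices for the nodes.\<close>
  define c where "c k = (if k = p then 1 else - l k)" for k
  define s where "s k = (if k = p then t else real (j + k) * h)" for k
  let ?\<beta> = "min T (real (j + p) * h)"
  let ?I = "\<lambda>\<beta>. LINT t|lebesgue_on {0<..<T}. \<bar>w t\<bar> * indicator {real j * h..\<beta>} t"
  have exact: "poly q t = (\<Sum>k<p. l k * poly q (real (j + k) * h))" if "degree q < p" for q
  proof -
    let ?q = "pcompose q [:real j * h, h:]"
    have "degree ?q < card {..<p}"
      using that degree_pcompose_le[of q "[:real j * h, h:]"] \<open>0 < h\<close> by simp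
    from lagrange_interpolation_exact[OF _ _ this, of real \<tau>]
    have "(\<Sum>k<p. l k * poly ?q (real k)) = poly ?q \<tau>"
      by (simp add: l_def)
    moreover have "real j * h + \<tau> * h = t" using \<open>0 < h\<close> by (simp add: \<tau>_def field_simps)
    ultimately show ?thesis by (simp add: poly_pcompose algebra_simps)
  qed
  have "\<bar>\<Sum>k\<le>p. c k * g (s k)\<bar> \<le> (\<Sum>k\<le>p. \<bar>c k\<bar>) * (?\<beta> - real j * h) ^ (p - 1) * ?I ?\<beta>"
  proof (rule weak_derivative_functional_bound[OF \<open>1 \<le> p\<close> _ _ _ _ _ _ g w])
    show "0 \<le> real j * h" "?\<beta> \<le> T" "finite {..p}" using \<open>0 < h\<close> by auto
    show "real j * h < ?\<beta>" using le(2) \<open>1 \<le> p\<close> \<open>0 < h\<close> by simp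
    show "s k \<in> {real j * h..?\<beta>}" if "k \<in> {..p}" for k
    proof (cases "k = p")
      case False
      with that have "j + k \<le> j + p - 1" by auto
      then have "real (j + k) * h \<le> real (j + p - 1) * h"
        using \<open>0 < h\<close> by (intro mult_right_mono) auto
      moreover have "real (j + p - 1) * h \<le> real (j + p) * h" "real j * h \<le> real (j + k) * h"
        using \<open>0 < h\<close> by (auto intro!: mult_right_mono)
      ultimately show ?thesis using le(1) False unfolding s_def by auto
    qed (use t in \<open>auto simp: s_def\<close>)
    show "(\<Sum>k\<le>p. c k * poly q (s k)) = 0" if "degree q < p" for q
      using exact[OF that] by (simp add: c_def s_def lessThan_Suc_atMost[symmetric] sum_negf)
  qed
  moreover have "(\<Sum>k\<le>p. c k * g (s k)) = g t - (\<Sum>k<p. l k * g (real (j + k) * h))"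
    by (simp add: c_def s_def lessThan_Suc_atMost[symmetric] sum_negf)
  moreover have "\<bar>\<Sum>k<p. l k * g (real (j + k) * h)\<bar> \<le> real p ^ p * (\<Sum>k<p. \<bar>g (real (j + k) * h)\<bar>)"
  proof -
    have "\<bar>\<Sum>k<p. l k * g (real (j + k) * h)\<bar> \<le> (\<Sum>k<p. \<bar>l k\<bar> * \<bar>g (real (j + k) * h)\<bar>)"
      unfolding abs_mult[symmetric] by (rule sum_abs)
    also have "\<dots> \<le> (\<Sum>k<p. real p ^ p * \<bar>g (real (j + k) * h)\<bar>)"
      by (intro sum_mono mult_right_mono l) simp
    finally show ?thesis by (simp add: sum_distrib_left)
  qed
  moreover have "(\<Sum>k\<le>p. \<bar>c k\<bar>) * (?\<beta> - real j * h) ^ (p - 1) * ?I ?\<beta>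
    \<le> (1 + real p * real p ^ p) * (real p * h) ^ (p - 1) * ?I (real (j + p) * h)"
  proof (intro mult_mono)
    have "(\<Sum>k<p. \<bar>l k\<bar>) \<le> (\<Sum>k<p. real p ^ p)" by (intro sum_mono l)
    then show "(\<Sum>k\<le>p. \<bar>c k\<bar>) \<le> 1 + real p * real p ^ p"
      by (simp add: c_def lessThan_Suc_atMost[symmetric])
    have "0 \<le> ?\<beta> - real j * h" "?\<beta> - real j * h \<le> real p * h"
      using le(2) \<open>0 < h\<close> by (auto simp: algebra_simps)
    then show "(?\<beta> - real j * h) ^ (p - 1) \<le> (real p * h) ^ (p - 1)" "0 \<le> (?\<beta> - real j * h) ^ (p - 1)"
      by (auto intro!: power_mono)
    show "?I ?\<beta> \<le> ?I (real (j + p) * h)"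
      by (intro integral_mono integrable_abs_times_indicator w(2) mult_left_mono)
        (auto simp: indicator_def)
    show "0 \<le> ?I ?\<beta>" by (intro Bochner_Integration.integral_nonneg) simp
  qed (use \<open>0 < h\<close> in \<open>auto intro!: mult_nonneg_nonneg add_nonneg_nonneg\<close>)
  ultimately show ?thesis by linarith
qed

text \<open>
A function is controlled by its grid values up to its \<open>p\<close>-th derivative. Each cell is covered by a
panel of \<open>p\<close> consecutive grid points starting at its left end, or at the last \<open>p\<close> available
points when the cell is close to the right end. A grid point or a time belongs to at most \<open>2 p\<close>
panels, so summing the panel bounds costs only a factor independent of \<open>N\<close>.
\<close>

lemma sampling_inequality:
  fixes g w :: "real \<Rightarrow> real" and p N e :: nat
  assumes "1 \<le> p" "0 < T" "1 \<le> N" and e: "p \<le> Suc e" "N \<le> Suc e" "e \<le> N"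
    and g: "continuous_on {0..T} g"
    and w: "weak_derivative 0 T p g w" "integrable (lebesgue_on {0<..<T}) w"
  shows "integral {0..T} (\<lambda>t. \<bar>g t\<bar>) \<le>
    2 * real p * real p ^ p * ((T / real N) * (\<Sum>m\<le>e. \<bar>g (real m * (T / real N))\<bar>))
    + 2 * real p * (1 + real p * real p ^ p) * real p ^ (p - 1) *
      ((T / real N) ^ p * (LINT t|lebesgue_on {0<..<T}. \<bar>w t\<bar>))"
proof -
  define h where "h = T / real N"
  have h: "0 < h" "real N * h = T" using assms by (simp_all add: h_def)
  define \<Lambda> where "\<Lambda> = real p ^ p"
  define K where "K = (1 + real p * \<Lambda>) * (real p * h) ^ (p - 1)"
  have "0 \<le> \<Lambda>" "0 \<le> K" using h by (simp_all add: \<Lambda>_def K_def)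
  define j where "j n = min n (Suc e - p)" for n
  have j: "j n \<le> n" "n < j n + p" "j n + p \<le> Suc e" if "n < N" for n
    using that e \<open>1 \<le> p\<close> by (auto simp: j_def)
  let ?M = "lebesgue_on {0<..<T}"
  let ?J = "\<lambda>n. {real (j n) * h..real (j n + p) * h}"
  let ?W = "\<lambda>n. LINT t|?M. \<bar>w t\<bar> * indicator (?J n) t"
  let ?G = "\<lambda>m. \<bar>g (real m * h)\<bar>"
  have overlap: "card {n. n < N \<and> j n \<le> m \<and> m \<le> j n + p} \<le> 2 * p" for m
  proof -
    have "{n. n < N \<and> j n \<le> m \<and> m \<le> j n + p} \<subseteq> {m - p..<m + p}"
      using j by force
    then have "card {n. n < N \<and> j n \<le> m \<and> m \<le> j n + p} \<le> card {m - p..<m + p}"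
      by (intro card_mono) auto
    then show ?thesis by simp
  qed
  have ag: "continuous_on {0..T} (\<lambda>t. \<bar>g t\<bar>)" by (intro continuous_intros g)
  have cell: "integral {real n * h..real (Suc n) * h} (\<lambda>t. \<bar>g t\<bar>)
      \<le> h * (\<Lambda> * (\<Sum>k<p. ?G (j n + k)) + K * ?W n)" if n: "n < N" for n
  proof -
    have mult_le: "real a * h \<le> real b * h" if "a \<le> b" for a b
      using that h(1) by (intro mult_right_mono) auto
    have "real (Suc n) * h \<le> T" using mult_le[of "Suc n" N] n h(2) by simp
    have "integral {real n * h..real (Suc n) * h} (\<lambda>t. \<bar>g t\<bar>)
      \<le> integral {real n * h..real (Suc n) * h} (\<lambda>t. \<Lambda> * (\<Sum>k<p. ?G (j n + k)) + K * ?W n)"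
    proof (intro integral_le integrable_continuous_real continuous_intros)
      show "continuous_on {real n * h..real (Suc n) * h} g"
        by (rule continuous_on_subset[OF g]) (use \<open>real (Suc n) * h \<le> T\<close> h(1) in auto)
      fix t assume t: "t \<in> {real n * h..real (Suc n) * h}"
      show "\<bar>g t\<bar> \<le> \<Lambda> * (\<Sum>k<p. ?G (j n + k)) + K * ?W n"
        unfolding \<Lambda>_def K_def
      proof (rule interpolation_panel_bound[OF \<open>1 \<le> p\<close> h(1) _ _ _ _ _ g w])
        show "real (j n) * h \<le> t" using mult_le[OF j(1)[OF n]] t by simp
        show "t \<le> real (j n + p) * h" using mult_le[of "Suc n" "j n + p"] j(2)[OF n] t by simp
        show "t \<le> T" using t \<open>real (Suc n) * h \<le> T\<close> by simp
        show "real (j n + p - 1) * h \<le> T"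
          using mult_le[of "j n + p - 1" N] j(3)[OF n] e h(2) by simp
        have "real (j n) * h < real N * h" using j(1)[OF n] n h(1) by simp
        then show "real (j n) * h < T" using h(2) by simp
      qed
    qed
    also have "\<dots> = h * (\<Lambda> * (\<Sum>k<p. ?G (j n + k)) + K * ?W n)"
      using h(1) by (simp add: algebra_simps)
    finally show ?thesis .
  qed
  have samples: "(\<Sum>n<N. \<Sum>k<p. ?G (j n + k)) \<le> 2 * real p * (\<Sum>m\<le>e. ?G m)"
  proof -
    have "(\<Sum>k<p. ?G (j n + k)) \<le> (\<Sum>m\<le>e. if j n \<le> m \<and> m \<le> j n + p then ?G m else 0)"
      if n: "n < N" for n
    proof -
      have "(\<Sum>k<p. ?G (j n + k)) = (\<Sum>m\<in>(\<lambda>k. j n + k) ` {..<p}. ?G m)"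
        by (subst sum.reindex) (auto intro: inj_onI)
      also have "\<dots> = (\<Sum>m\<in>(\<lambda>k. j n + k) ` {..<p}. if j n \<le> m \<and> m \<le> j n + p then ?G m else 0)"
        by (intro sum.cong) auto
      also have "\<dots> \<le> (\<Sum>m\<le>e. if j n \<le> m \<and> m \<le> j n + p then ?G m else 0)"
        by (intro sum_mono2) (use j(3)[OF n] in auto)
      finally show ?thesis .
    qed
    then have "(\<Sum>n<N. \<Sum>k<p. ?G (j n + k)) \<le> (\<Sum>n<N. \<Sum>m\<le>e. if j n \<le> m \<and> m \<le> j n + p then ?G m else 0)"
      by (intro sum_mono) simp
    also have "\<dots> = (\<Sum>m\<le>e. real (card {n. n < N \<and> j n \<le> m \<and> m \<le> j n + p}) * ?G m)"
      by (subst sum.swap) (simp add: sum.If_cases Int_def)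
    also have "\<dots> \<le> (\<Sum>m\<le>e. 2 * real p * ?G m)"
    proof (intro sum_mono mult_right_mono)
      show "real (card {n. n < N \<and> j n \<le> m \<and> m \<le> j n + p}) \<le> 2 * real p" for m
        using overlap[of m] of_nat_mono[of _ "2 * p", where 'a = real] by simp
    qed simp
    finally show ?thesis by (simp add: sum_distrib_left)
  qed
  have weights: "(\<Sum>n<N. ?W n) \<le> 2 * real p * (LINT t|?M. \<bar>w t\<bar>)"
  proof -
    have "(\<Sum>n<N. ?W n) = (LINT t|?M. (\<Sum>n<N. \<bar>w t\<bar> * indicator (?J n) t))"
      by (intro Bochner_Integration.integral_sum[symmetric] integrable_abs_times_indicator w)
    also have "\<dots> \<le> (LINT t|?M. 2 * real p * \<bar>w t\<bar>)"
    proof (intro integral_mono)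
      show "integrable ?M (\<lambda>t. \<Sum>n<N. \<bar>w t\<bar> * indicator (?J n) t)"
        by (intro Bochner_Integration.integrable_sum integrable_abs_times_indicator w)
      show "integrable ?M (\<lambda>t. 2 * real p * \<bar>w t\<bar>)"
        using w by (intro integrable_mult_right integrable_abs)
      fix t assume "t \<in> space ?M"
      then have "0 < t" by simp
      define m where "m = nat \<lfloor>t / h\<rfloor>"
      have m: "real m \<le> t / h" "t / h < real m + 1"
        using \<open>0 < t\<close> h(1) by (auto simp: m_def)
      have sub: "{n. n < N \<and> t \<in> ?J n} \<subseteq> {n. n < N \<and> j n \<le> m \<and> m \<le> j n + p}"
      proof safe
        fix n assume n: "t \<in> ?J n"
        then have "real (j n) \<le> t / h" "t / h \<le> real (j n + p)" using h(1) by (simp_all add: field_simps)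
        with m have "real (j n) < real (Suc m)" "real m \<le> real (j n + p)" by linarith+
        then show "j n \<le> m" "m \<le> j n + p" by linarith+
      qed
      have "(\<Sum>n<N. indicator (?J n) t :: real) = real (card {n. n < N \<and> t \<in> ?J n})"
        by (simp add: indicator_def sum.If_cases Int_def)
      also have "\<dots> \<le> real (2 * p)"
        using card_mono[OF _ sub] overlap[of m] by (intro of_nat_mono) simp
      finally have "\<bar>w t\<bar> * (\<Sum>n<N. indicator (?J n) t) \<le> \<bar>w t\<bar> * (2 * real p)"
        by (intro mult_left_mono) auto
      then show "(\<Sum>n<N. \<bar>w t\<bar> * indicator (?J n) t) \<le> 2 * real p * \<bar>w t\<bar>"
        by (simp add: sum_distrib_left mult.commute)
    qed
    finally show ?thesis by simp
  qed
  have "integral {0..T} (\<lambda>t. \<bar>g t\<bar>) = (\<Sum>n<N. integral {real n * h..real (Suc n) * h} (\<lambda>t. \<bar>g t\<bar>))"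
    using integral_uniform_partition[of h N "\<lambda>t. \<bar>g t\<bar>"] h ag by simp
  also have "\<dots> \<le> (\<Sum>n<N. h * (\<Lambda> * (\<Sum>k<p. ?G (j n + k)) + K * ?W n))"
    by (intro sum_mono cell) simp
  also have "\<dots> = h * \<Lambda> * (\<Sum>n<N. \<Sum>k<p. ?G (j n + k)) + h * K * (\<Sum>n<N. ?W n)"
    by (simp add: sum_distrib_left sum.distrib algebra_simps)
  also have "\<dots> \<le> h * \<Lambda> * (2 * real p * (\<Sum>m\<le>e. ?G m)) + h * K * (2 * real p * (LINT t|?M. \<bar>w t\<bar>))"
    using h(1) \<open>0 \<le> \<Lambda>\<close> \<open>0 \<le> K\<close> samples weights by (intro add_mono mult_left_mono) auto
  also have "h * K * (2 * real p * (LINT t|?M. \<bar>w t\<bar>)) =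
      2 * real p * (1 + real p * \<Lambda>) * real p ^ (p - 1) * ((h * h ^ (p - 1)) * (LINT t|?M. \<bar>w t\<bar>))"
    by (simp add: K_def power_mult_distrib mult_ac)
  also have "h * h ^ (p - 1) = h ^ p"
    using \<open>1 \<le> p\<close> by (cases p) auto
  finally show ?thesis
    by (simp only: h_def[symmetric] \<Lambda>_def[symmetric] mult_ac)
qed

section \<open>Truncation error of Adams schemes\<close>

lemma prod_index_differences:
  assumes "a \<le> m" "m \<le> M"
  shows "(\<Prod>i\<in>{a..M} - {m}. real i - real m) = (- 1) ^ (m - a) * (fact (m - a) * fact (M - m))"
proof -
  have split: "{a..M} - {m} = {a..<m} \<union> {m<..M}" using assms by auto
  have "(\<Prod>i\<in>{a..M} - {m}. real i - real m)
      = (\<Prod>i\<in>{a..<m}. real i - real m) * (\<Prod>i\<in>{m<..M}. real i - real m)"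
    unfolding split by (rule prod.union_disjoint) auto
  moreover have "(\<Prod>i\<in>{m<..M}. real i - real m) = fact (M - m)"
  proof -
    have "(\<Prod>i\<in>{m<..M}. real i - real m) = (\<Prod>i\<in>{1..M - m}. real i)"
      using assms
      by (intro prod.reindex_bij_witness[of _ "\<lambda>i. i + m" "\<lambda>i. i - m"]) auto
    then show ?thesis by (simp add: fact_prod)
  qed
  moreover have "(\<Prod>i\<in>{a..<m}. real i - real m) = (- 1) ^ (m - a) * fact (m - a)"
  proof -
    have "(\<Prod>i\<in>{a..<m}. real i - real m) = (\<Prod>i\<in>{1..m - a}. (- 1) * real i)"
      using assms
      by (intro prod.reindex_bij_witness[of _ "\<lambda>i. m - i" "\<lambda>i. m - i"]) auto
    then show ?thesis unfolding prod.distrib by (simp add: fact_prod)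
  qed
  ultimately show ?thesis by simp
qed

text \<open>
Position of the sample with lag \<open>m\<close>, in units of the step, when the step to be integrated is \<open>[0, 1]\<close>.
\<close>

abbreviation adams_node :: "nat \<Rightarrow> real" where
  "adams_node m \<equiv> 1 - real m"

text \<open>
Adams schemes are interpolatory quadratures: a weight is the integral of a Lagrange basis
polynomial over the last step. The factorials are the products of differences of the nodes.
\<close>

lemma adams_beta_eq_integral_lagrange_basis:
  assumes "1 \<le> M" "m \<in> {first_lag s..M}"
  shows "adams_beta s M m = integral {0..1} (lagrange_basis adams_node {first_lag s..M} m)"
proof -
  let ?K = "{first_lag s..M}" and ?a = "first_lag s"
  let ?c = "(- 1) ^ (m - ?a) * (fact (m - ?a) * fact (M - m)) :: real"
  have "lagrange_basis adams_node ?K m u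
      = (- 1) ^ (m - ?a) / (fact (m - ?a) * fact (M - m)) * (\<Prod>i\<in>?K - {m}. u + real i - 1)" for u
  proof -
    have "lagrange_basis adams_node ?K m u = (\<Prod>i\<in>?K - {m}. (u + real i - 1) / (real i - real m))"
      unfolding lagrange_basis_def by (intro prod.cong refl) (simp add: algebra_simps)
    also have "\<dots> = (\<Prod>i\<in>?K - {m}. u + real i - 1) / ?c"
      using assms(2) by (simp add: prod_dividef prod_index_differences)
    also have "\<dots> = (- 1) ^ (m - ?a) / (fact (m - ?a) * fact (M - m)) * (\<Prod>i\<in>?K - {m}. u + real i - 1)"
      by (cases "even (m - ?a)") simp_all
    finally show ?thesis .
  qed
  then have "lagrange_basis adams_node ?K m = (\<lambda>u. (- 1) ^ (m - ?a) / (fact (m - ?a) * fact (M - m)) *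
      (\<Prod>i\<in>?K - {m}. u + real i - 1))"
    by (rule ext)
  then have eq: "integral {0..1} (lagrange_basis adams_node ?K m) =
    (- 1) ^ (m - ?a) / (fact (m - ?a) * fact (M - m)) *
      integral {0..1} (\<lambda>u. \<Prod>i\<in>?K - {m}. u + real i - 1)"
    by (simp only: integral_mult_right)
  show ?thesis
  proof (cases s)
    case AB
    have "(\<Prod>i\<in>{0..M - 1} - {m - 1}. u + real i) = (\<Prod>i\<in>{1..M} - {m}. u + real i - 1)" for u
      using assms AB
      by (intro prod.reindex_bij_witness[of _ "\<lambda>i. i - 1" "\<lambda>i. i + 1"]) auto
    then show ?thesis using assms AB eq by simp
  next
    case AM
    have "{first_lag s..M} = {0..M}" using AM by simp
    then show ?thesis using assms AM eq by simp
  qed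
qed

text \<open>
Expanding at the left end \<open>a\<close> needs one-sided derivatives only; the constant bounds the \<open>p\<close>-th
derivative on the whole compact interval, so it serves every \<open>a\<close>.
\<close>

lemma taylor_polynomial_one_sided:
  fixes Y :: "nat \<Rightarrow> real \<Rightarrow> real"
  assumes "1 \<le> p"
    and Y: "\<And>k t. t \<in> {0..T} \<Longrightarrow> (Y k has_vector_derivative Y (Suc k) t) (at t within {0..T})"
  obtains B where "0 \<le> B"
    "\<And>a. a \<in> {0..T} \<Longrightarrow> \<exists>P. degree P < p \<and> (\<forall>t\<in>{a..T}. \<bar>Y 0 t - poly P t\<bar> \<le> B * (t - a) ^ p)"
proof -
  have cont: "continuous_on {0..T} (Y k)" for k
    using Y by (intro continuous_on_vector_derivative) auto
  have "bounded (Y p ` {0..T})"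
    by (intro compact_imp_bounded compact_continuous_image cont) simp
  then obtain B where "\<forall>v\<in>Y p ` {0..T}. norm v \<le> B"
    unfolding bounded_iff by blast
  then have B': "\<bar>Y p t\<bar> \<le> \<bar>B\<bar>" if "t \<in> {0..T}" for t
  proof -
    have "norm (Y p t) \<le> B" using \<open>\<forall>v\<in>Y p ` {0..T}. norm v \<le> B\<close> that by blast
    then show ?thesis by simp
  qed
  show thesis
  proof (rule that)
    show "0 \<le> \<bar>B\<bar>" by simp
    fix a assume a: "a \<in> {0..T}"
    define P where "P = (\<Sum>i<p. Polynomial.smult (Y i a / fact i) ([:- a, 1:] ^ i))"
    have "degree (Polynomial.smult (Y i a / fact i) ([:- a, 1:] ^ i)) \<le> p - 1" if "i < p" for i
      using that degree_power_le[of "[:- a, 1:]" i]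
      by (intro order_trans[OF degree_smult_le]) simp
    then have "degree P \<le> p - 1" unfolding P_def by (intro degree_sum_le) auto
    then have "degree P < p" using \<open>1 \<le> p\<close> by simp
    moreover have "\<bar>Y 0 t - poly P t\<bar> \<le> \<bar>B\<bar> * (t - a) ^ p" if t: "t \<in> {a..T}" for t
    proof -
      let ?R = "\<lambda>x. ((t - x) ^ (p - 1) / fact (p - 1)) *\<^sub>R Y p x"
      have der: "(Y m has_vector_derivative Y (Suc m) x) (at x within {a..t})"
        if "m < p" "a \<le> x" "x \<le> t" for m x
        using that a t by (intro has_vector_derivative_within_subset[OF Y]) auto
      have "(?R has_integral Y 0 t - (\<Sum>i<p. ((t - a) ^ i / fact i) *\<^sub>R Y i a)) {a..t}"
        using \<open>1 \<le> p\<close> t by (intro Taylor_has_integral der refl) auto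
      moreover have "(\<Sum>i<p. ((t - a) ^ i / fact i) *\<^sub>R Y i a) = poly P t"
        unfolding P_def poly_sum by (intro sum.cong refl) simp
      ultimately have "(?R has_integral Y 0 t - poly P t) (cbox a t)" by simp
      moreover have "norm (?R x) \<le> \<bar>B\<bar> * (t - a) ^ (p - 1)" if x: "x \<in> cbox a t" for x
      proof -
        have x': "a \<le> x" "x \<le> t" using x by auto
        have "(t - x) ^ (p - 1) / fact (p - 1) \<le> (t - a) ^ (p - 1) / 1"
          using x' by (intro frac_le power_mono) auto
        then have "(t - x) ^ (p - 1) / fact (p - 1) * \<bar>Y p x\<bar> \<le> (t - a) ^ (p - 1) * \<bar>B\<bar>"
          using x' a t B'[of x] by (intro mult_mono) auto
        then show ?thesis using x' by (simp add: abs_mult mult.commute)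
      qed
      ultimately have "norm (Y 0 t - poly P t) \<le> \<bar>B\<bar> * (t - a) ^ (p - 1) * Henstock_Kurzweil_Integration.content (cbox a t)"
        using t by (intro has_integral_bound) auto
      then show ?thesis
        using t \<open>1 \<le> p\<close> by (cases p) (auto simp: mult_ac)
    qed
    ultimately show "\<exists>P. degree P < p \<and> (\<forall>t\<in>{a..T}. \<bar>Y 0 t - poly P t\<bar> \<le> \<bar>B\<bar> * (t - a) ^ p)"
      by blast
  qed
qed

text \<open>
The quadrature integrates the interpolant of \<open>z\<close>. Interpolation reproduces \<open>P\<close> and is bounded, so
its error is that of approximating \<open>z\<close> by \<open>P\<close>, times a constant depending on the scheme.
\<close>

lemma adams_quadrature_error:
  fixes z :: "real \<Rightarrow> real"
  assumes "1 \<le> M" "continuous_on {0..1} z" "degree P < adams_order s M"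
    and near: "\<And>u. u \<in> {0..1} \<union> adams_node ` {first_lag s..M} \<Longrightarrow> \<bar>z u - poly P u\<bar> \<le> D"
  shows "\<bar>integral {0..1} z - (\<Sum>m\<in>{first_lag s..M}. adams_beta s M m * z (adams_node m))\<bar>
    \<le> (1 + real (adams_order s M) * real M ^ adams_order s M) * D"
proof -
  let ?K = "{first_lag s..M}" and ?p = "adams_order s M"
  let ?l = "lagrange_basis adams_node ?K"
  have card: "card ?K = ?p" by (cases s) auto
  have "0 \<le> D" by (rule order_trans[OF abs_ge_zero near[of 0]]) simp
  have cont: "continuous_on {0..1} (?l m)" for m
    unfolding lagrange_basis_def by (cases "finite ?K") (auto intro!: continuous_intros)
  have "(\<Sum>m\<in>?K. adams_beta s M m * z (adams_node m)) = (\<Sum>m\<in>?K. integral {0..1} (\<lambda>u. ?l m u * z (adams_node m)))"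
    by (intro sum.cong refl) (simp only: adams_beta_eq_integral_lagrange_basis[OF assms(1)] integral_mult_left)
  also have "\<dots> = integral {0..1} (\<lambda>u. \<Sum>m\<in>?K. ?l m u * z (adams_node m))"
    by (intro integral_sum[symmetric] integrable_continuous_real continuous_intros cont) auto
  finally have "integral {0..1} z - (\<Sum>m\<in>?K. adams_beta s M m * z (adams_node m))
      = integral {0..1} (\<lambda>u. z u - (\<Sum>m\<in>?K. ?l m u * z (adams_node m)))"
    by (simp add: integral_diff integrable_continuous_real assms(2) continuous_intros cont)
  also have "norm \<dots> \<le> ((1 + real ?p * real M ^ ?p) * D) * (1 - 0)"
  proof (intro integral_bound)
    show "continuous_on {0..1} (\<lambda>u. z u - (\<Sum>m\<in>?K. ?l m u * z (adams_node m)))"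
      by (intro continuous_intros cont assms)
    fix u :: real assume u: "u \<in> {0..1}"
    have l: "\<bar>?l m u\<bar> \<le> real M ^ ?p" if "m \<in> ?K" for m
      unfolding card[symmetric] using u \<open>1 \<le> M\<close> by (intro lagrange_basis_bound) auto
    have "poly P u = (\<Sum>m\<in>?K. ?l m u * poly P (adams_node m))"
      using assms(3) card by (intro lagrange_interpolation_exact[symmetric]) (auto simp: inj_on_def)
    then have "z u - (\<Sum>m\<in>?K. ?l m u * z (adams_node m))
      = (z u - poly P u) - (\<Sum>m\<in>?K. ?l m u * (z (adams_node m) - poly P (adams_node m)))"
      by (simp add: right_diff_distrib sum_subtractf)
    also have "norm \<dots> \<le> \<bar>z u - poly P u\<bar> + (\<Sum>m\<in>?K. \<bar>?l m u\<bar> * \<bar>z (adams_node m) - poly P (adams_node m)\<bar>)"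
      unfolding real_norm_def abs_mult[symmetric]
      by (rule order_trans[OF abs_triangle_ineq4]) (intro add_left_mono sum_abs)
    also have "\<dots> \<le> D + (\<Sum>m\<in>?K. real M ^ ?p * D)"
      by (intro add_mono sum_mono mult_mono near l) (use u in auto)
    also have "\<dots> = (1 + real ?p * real M ^ ?p) * D"
      by (simp only: sum_constant card) (simp add: algebra_simps)
    finally show "norm (z u - (\<Sum>m\<in>?K. ?l m u * z (adams_node m))) \<le> (1 + real ?p * real M ^ ?p) * D" .
  qed simp
  finally show ?thesis by simp
qed

text \<open>
The difference quotient of \<open>y\<close> is the mean of \<open>y'\<close> over the last step. Rescaled to \<open>[0, 1]\<close>, the
Taylor polynomial of \<open>y'\<close> at the oldest sample approximates it to order \<open>h\<^sup>p\<close> at all samples and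
on the whole step, which is what the quadrature estimate asks for.
\<close>

lemma adams_truncation_error:
  fixes y :: "real \<Rightarrow> real" and Y :: "nat \<Rightarrow> real \<Rightarrow> real"
  assumes "1 \<le> M" "0 < T"
    and y: "\<And>t. t \<in> {0..T} \<Longrightarrow> (y has_vector_derivative Y 0 t) (at t within {0..T})"
    and Y: "\<And>k t. t \<in> {0..T} \<Longrightarrow> (Y k has_vector_derivative Y (Suc k) t) (at t within {0..T})"
  obtains C where "0 \<le> C"
    "\<And>n N. M \<le> n \<Longrightarrow> n \<le> N \<Longrightarrow>
      \<bar>(\<Sum>m = 0..M. adams_alpha m * y (grid T N (n - m))) / step T N
        - (\<Sum>m\<in>{first_lag s..M}. adams_beta s M m * Y 0 (grid T N (n - m)))\<bar>
      \<le> C * step T N ^ adams_order s M"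
proof -
  let ?p = "adams_order s M"
  have "1 \<le> ?p" using \<open>1 \<le> M\<close> by (cases s) auto
  obtain B where "0 \<le> B" and
    B: "\<And>a. a \<in> {0..T} \<Longrightarrow> \<exists>P. degree P < ?p \<and> (\<forall>t\<in>{a..T}. \<bar>Y 0 t - poly P t\<bar> \<le> B * (t - a) ^ ?p)"
    by (rule taylor_polynomial_one_sided[of ?p T Y, OF \<open>1 \<le> ?p\<close> Y]) (assumption, rule that)
  let ?C = "(1 + real ?p * real M ^ ?p) * (B * real M ^ ?p)"
  show thesis
  proof (rule that)
    show "0 \<le> ?C" using \<open>0 \<le> B\<close> by simp
    fix n N assume n: "M \<le> n" "n \<le> N"
    define h where "h = step T N"
    have "1 \<le> N" using n \<open>1 \<le> M\<close> by simp
    then have h: "0 < h" "real N * h = T" using \<open>0 < T\<close> by (simp_all add: h_def step_def)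
    \<comment> \<open>\<open>\<sigma>\<close> maps \<open>[0, 1]\<close> to the last step, and the nodes to the sample times; \<open>a\<close> is the oldest one.\<close>
    define a where "a = real (n - M) * h"
    define \<sigma> where "\<sigma> u = real (n - 1) * h + u * h" for u
    define z where "z u = Y 0 (\<sigma> u)" for u
    have node: "\<sigma> (adams_node m) = grid T N (n - m)" if "m \<le> M" for m
      using that n \<open>1 \<le> M\<close> by (simp add: \<sigma>_def grid_def h_def algebra_simps of_nat_diff)
    have a: "a \<in> {0..T}"
    proof -
      have "real (n - M) * h \<le> real N * h" using h(1) n by (intro mult_right_mono) auto
      then show ?thesis using h by (simp add: a_def)
    qed
    have \<sigma>: "\<sigma> u \<in> {a..T}" "\<sigma> u - a \<le> real M * h" if "1 - real M \<le> u" "u \<le> 1" for u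
    proof -
      have e1: "\<sigma> u - a = (u - (1 - real M)) * h"
        using n \<open>1 \<le> M\<close> by (simp add: \<sigma>_def a_def algebra_simps of_nat_diff)
      have "(u - (1 - real M)) * h \<le> real M * h"
        using h(1) that by (intro mult_right_mono) auto
      then show "\<sigma> u - a \<le> real M * h" using e1 by simp
      have "real (n - 1) * h + u * h \<le> real N * h"
        unfolding distrib_right[symmetric]
        using h(1) that n \<open>1 \<le> M\<close> by (intro mult_right_mono) (auto simp: of_nat_diff)
      moreover have "0 \<le> \<sigma> u - a" unfolding e1 using h(1) that by simp
      ultimately show "\<sigma> u \<in> {a..T}" using h(2) by (simp add: \<sigma>_def)
    qed
    have \<sigma>01: "\<sigma> u \<in> {0..T}" if "u \<in> {0..1}" for u
      using \<sigma>(1)[of u] that a \<open>1 \<le> M\<close> by auto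
    have contY: "continuous_on {0..T} (Y 0)"
      using Y by (intro continuous_on_vector_derivative) auto
    have contz: "continuous_on {0..1} z"
      unfolding z_def by (intro continuous_on_compose2[OF contY]) (auto simp: \<sigma>_def[abs_def] intro!: continuous_intros \<sigma>01[unfolded \<sigma>_def, simplified])
    obtain P where P: "degree P < ?p" "\<And>t. t \<in> {a..T} \<Longrightarrow> \<bar>Y 0 t - poly P t\<bar> \<le> B * (t - a) ^ ?p"
      using B[OF a] by auto
    let ?P = "pcompose P [:real (n - 1) * h, h:]"
    have "degree ?P < ?p"
      using P(1) degree_pcompose_le[of P "[:real (n - 1) * h, h:]"] h(1) by simp
    moreover have "\<bar>z u - poly ?P u\<bar> \<le> B * (real M * h) ^ ?p"
      if "u \<in> {0..1} \<union> adams_node ` {first_lag s..M}" for u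
    proof -
      have u: "1 - real M \<le> u" "u \<le> 1" using that \<open>1 \<le> M\<close> by auto
      have "\<bar>z u - poly ?P u\<bar> \<le> B * (\<sigma> u - a) ^ ?p"
        using P(2)[OF \<sigma>(1)[OF u]] by (simp add: z_def poly_pcompose \<sigma>_def)
      also have "\<dots> \<le> B * (real M * h) ^ ?p"
        using \<sigma>[OF u] \<open>0 \<le> B\<close> by (intro mult_left_mono power_mono) auto
      finally show ?thesis .
    qed
    ultimately have "\<bar>integral {0..1} z - (\<Sum>m\<in>{first_lag s..M}. adams_beta s M m * z (adams_node m))\<bar>
      \<le> (1 + real ?p * real M ^ ?p) * (B * (real M * h) ^ ?p)"
      by (rule adams_quadrature_error[OF \<open>1 \<le> M\<close> contz])
    moreover have "(\<Sum>m\<in>{first_lag s..M}. adams_beta s M m * z (adams_node m)) =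
        (\<Sum>m\<in>{first_lag s..M}. adams_beta s M m * Y 0 (grid T N (n - m)))"
    proof (intro sum.cong refl)
      fix m assume "m \<in> {first_lag s..M}"
      then have "m \<le> M" by simp
      show "adams_beta s M m * z (adams_node m) = adams_beta s M m * Y 0 (grid T N (n - m))"
        unfolding z_def node[OF \<open>m \<le> M\<close>] ..
    qed
    moreover have "integral {0..1} z = (\<Sum>m = 0..M. adams_alpha m * y (grid T N (n - m))) / step T N"
    proof -
      have "((\<lambda>u. y (\<sigma> u) / h) has_vector_derivative z u) (at u within {0..1})" if u: "u \<in> {0..1}" for u
      proof -
        have "(y has_real_derivative Y 0 (\<sigma> u)) (at (\<sigma> u) within \<sigma> ` {0..1})"
        proof (rule DERIV_subset)
          show "(y has_real_derivative Y 0 (\<sigma> u)) (at (\<sigma> u) within {0..T})"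
            unfolding has_real_derivative_iff_has_vector_derivative by (rule y[OF \<sigma>01[OF u]])
          show "\<sigma> ` {0..1} \<subseteq> {0..T}" using \<sigma>01 by blast
        qed
        moreover have "(\<sigma> has_real_derivative h) (at u within {0..1})"
          unfolding \<sigma>_def[abs_def] by (auto intro!: derivative_eq_intros)
        ultimately have "(y \<circ> \<sigma> has_real_derivative Y 0 (\<sigma> u) * h) (at u within {0..1})"
          by (rule DERIV_image_chain)
        from DERIV_cdivide[OF this, of h] show ?thesis
          using h(1) by (simp add: o_def z_def has_real_derivative_iff_has_vector_derivative)
      qed
      then have "(z has_integral y (\<sigma> 1) / h - y (\<sigma> 0) / h) {0..1}"
        by (intro fundamental_theorem_of_calculus) auto
      moreover have "\<sigma> 1 = grid T N n" "\<sigma> 0 = grid T N (n - 1)"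
        using node[of 0] node[of 1] \<open>1 \<le> M\<close> by auto
      moreover have "(\<Sum>m = 0..M. adams_alpha m * y (grid T N (n - m))) = y (grid T N n) - y (grid T N (n - 1))"
      proof -
        have "(\<Sum>m = 0..M. adams_alpha m * y (grid T N (n - m))) = (\<Sum>m\<in>{0, 1}. adams_alpha m * y (grid T N (n - m)))"
          using \<open>1 \<le> M\<close> by (intro sum.mono_neutral_right) auto
        then show ?thesis by simp
      qed
      ultimately show ?thesis
        by (simp add: integral_unique h_def diff_divide_distrib)
    qed
    ultimately show "\<bar>(\<Sum>m = 0..M. adams_alpha m * y (grid T N (n - m))) / step T N
        - (\<Sum>m\<in>{first_lag s..M}. adams_beta s M m * Y 0 (grid T N (n - m)))\<bar>
      \<le> ?C * step T N ^ ?p"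
      by (simp add: h_def power_mult_distrib mult_ac)
  qed
qed

section \<open>Stability of the discovery matrix\<close>

lemma norm2_vec_eq_L2_set_abs: "norm2_vec v = L2_set (\<lambda>i. \<bar>vec_index v i\<bar>) {0..<dim_vec v}"
  by (simp add: norm2_vec_def L2_set_def)

lemma norm2_vec_nonneg: "0 \<le> norm2_vec v"
  by (simp add: norm2_vec_def L2_set_nonneg)

lemma norm2_vec_add_le:
  assumes "v \<in> carrier_vec n" "w \<in> carrier_vec n"
  shows "norm2_vec (v + w) \<le> norm2_vec v + norm2_vec w"
proof -
  have "norm2_vec (v + w) = L2_set (\<lambda>i. vec_index v i + vec_index w i) {0..<n}"
    unfolding norm2_vec_def using assms by (intro L2_set_cong) auto
  then show ?thesis
    using L2_set_triangle_ineq[of "vec_index v" "vec_index w" "{0..<n}"] assms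
    by (simp add: norm2_vec_def)
qed

lemma norm2_vec_minus_le:
  assumes "v \<in> carrier_vec n" "w \<in> carrier_vec n"
  shows "norm2_vec (v - w) \<le> norm2_vec v + norm2_vec w"
proof -
  have "norm2_vec (v - w) = L2_set (\<lambda>i. vec_index v i + - vec_index w i) {0..<n}"
    unfolding norm2_vec_def using assms by (intro L2_set_cong) auto
  also have "\<dots> \<le> L2_set (vec_index v) {0..<n} + L2_set (\<lambda>i. - vec_index w i) {0..<n}"
    by (rule L2_set_triangle_ineq)
  also have "L2_set (\<lambda>i. - vec_index w i) {0..<n} = L2_set (vec_index w) {0..<n}"
    by (simp add: L2_set_def)
  finally show ?thesis using assms by (simp add: norm2_vec_def)
qed

lemma norm2_vec_smult: "norm2_vec (c \<cdot>\<^sub>v v) = \<bar>c\<bar> * norm2_vec v"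
proof -
  have "norm2_vec (c \<cdot>\<^sub>v v) = L2_set (\<lambda>i. \<bar>c\<bar> * \<bar>vec_index v i\<bar>) {0..<dim_vec v}"
    unfolding norm2_vec_def L2_set_def by (simp add: power_mult_distrib)
  then show ?thesis
    unfolding norm2_vec_eq_L2_set_abs by (simp flip: L2_set_right_distrib)
qed

lemma norm2_vec_le_sqrt_dim:
  assumes "v \<in> carrier_vec n" "\<And>i. i < n \<Longrightarrow> \<bar>vec_index v i\<bar> \<le> c" "0 \<le> c"
  shows "norm2_vec v \<le> sqrt (real n) * c"
proof -
  have "norm2_vec v = L2_set (\<lambda>i. \<bar>vec_index v i\<bar>) {0..<n}"
    using assms(1) by (simp add: norm2_vec_eq_L2_set_abs)
  also have "\<dots> \<le> L2_set (\<lambda>_. c) {0..<n}"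
    using assms by (intro L2_set_mono) auto
  also have "\<dots> = sqrt (real n) * c"
    using assms(3) by (simp add: L2_set_constant)
  finally show ?thesis .
qed

lemma sum_abs_le_sqrt_dim_norm2_vec:
  assumes "v \<in> carrier_vec n"
  shows "(\<Sum>i<n. \<bar>vec_index v i\<bar>) \<le> sqrt (real n) * norm2_vec v"
proof -
  have "(\<Sum>i<n. \<bar>vec_index v i\<bar> * \<bar>1\<bar>) \<le> L2_set (vec_index v) {..<n} * L2_set (\<lambda>_. 1) {..<n}"
    by (rule L2_set_mult_ineq)
  then show ?thesis
    using assms by (simp add: norm2_vec_def L2_set_constant lessThan_atLeast0 mult.commute)
qed

lemma abs_vec_index_le_norm2_vec:
  "i < dim_vec v \<Longrightarrow> \<bar>vec_index v i\<bar> \<le> norm2_vec v"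
  using member_le_L2_set[of "{0..<dim_vec v}" i "\<lambda>i. \<bar>vec_index v i\<bar>"]
  by (simp add: norm2_vec_eq_L2_set_abs)

lemma bdd_above_norm2_mat:
  "bdd_above ((\<lambda>v. norm2_vec (A *\<^sub>v v)) ` {v \<in> carrier_vec (dim_col A). norm2_vec v = 1})"
proof (rule bdd_aboveI2)
  fix v assume "v \<in> {v \<in> carrier_vec (dim_col A). norm2_vec v = 1}"
  then have v: "v \<in> carrier_vec (dim_col A)" "norm2_vec v = 1" by auto
  have "norm2_vec (A *\<^sub>v v) \<le> (\<Sum>i\<in>{0..<dim_row A}. \<bar>vec_index (A *\<^sub>v v) i\<bar>)"
    using L2_set_le_sum_abs[of "vec_index (A *\<^sub>v v)" "{0..<dim_row A}"]
    by (simp add: norm2_vec_def del: index_mult_mat_vec)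
  also have "\<dots> \<le> (\<Sum>i\<in>{0..<dim_row A}. \<Sum>j\<in>{0..<dim_col A}. \<bar>A $$ (i, j)\<bar>)"
  proof (rule sum_mono)
    fix i assume i: "i \<in> {0..<dim_row A}"
    have "vec_index (A *\<^sub>v v) i = (\<Sum>j\<in>{0..<dim_col A}. A $$ (i, j) * vec_index v j)"
      using i v by (auto simp: scalar_prod_def intro!: sum.cong)
    also have "\<bar>\<dots>\<bar> \<le> (\<Sum>j\<in>{0..<dim_col A}. \<bar>A $$ (i, j)\<bar> * \<bar>vec_index v j\<bar>)"
      unfolding abs_mult[symmetric] by (rule sum_abs)
    also have "\<dots> \<le> (\<Sum>j\<in>{0..<dim_col A}. \<bar>A $$ (i, j)\<bar> * 1)"
      using v abs_vec_index_le_norm2_vec[of _ v] by (intro sum_mono mult_left_mono) auto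
    finally show "\<bar>vec_index (A *\<^sub>v v) i\<bar> \<le> (\<Sum>j\<in>{0..<dim_col A}. \<bar>A $$ (i, j)\<bar>)" by simp
  qed
  finally show "norm2_vec (A *\<^sub>v v) \<le> (\<Sum>i\<in>{0..<dim_row A}. \<Sum>j\<in>{0..<dim_col A}. \<bar>A $$ (i, j)\<bar>)" .
qed

lemma norm2_mult_mat_vec_le:
  assumes A: "A \<in> carrier_mat m n" and v: "v \<in> carrier_vec n"
  shows "norm2_vec (A *\<^sub>v v) \<le> norm2_mat A * norm2_vec v"
proof (cases "norm2_vec v = 0")
  case True
  have "vec_index v j = 0" if "j < n" for j
    using abs_vec_index_le_norm2_vec[of j v] that True v by simp
  then have "norm2_vec (A *\<^sub>v v) \<le> sqrt (real m) * 0"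
    using A v by (intro norm2_vec_le_sqrt_dim) (auto simp: scalar_prod_def)
  then show ?thesis using True by simp
next
  case False
  define r where "r = norm2_vec v"
  have "0 < r" using False norm2_vec_nonneg[of v] by (simp add: r_def)
  define u where "u = (1 / r) \<cdot>\<^sub>v v"
  have u: "u \<in> carrier_vec n" using v by (simp add: u_def)
  have "norm2_vec u = 1" using \<open>0 < r\<close> unfolding u_def norm2_vec_smult by (simp add: r_def)
  then have "norm2_vec (A *\<^sub>v u) \<le> norm2_mat A"
    unfolding norm2_mat_def using u A by (intro cSUP_upper bdd_above_norm2_mat) auto
  moreover have "A *\<^sub>v u = (1 / r) \<cdot>\<^sub>v (A *\<^sub>v v)"
    using A v by (simp add: u_def mult_mat_vec)
  ultimately show ?thesis
    using \<open>0 < r\<close> unfolding r_def[symmetric] by (simp add: norm2_vec_smult field_simps)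
qed

lemma abs_entry_le_norm2_mat:
  assumes A: "A \<in> carrier_mat m n" and "i < m" "j < n"
  shows "\<bar>A $$ (i, j)\<bar> \<le> norm2_mat A"
proof -
  have e: "norm2_vec (unit_vec n j) = 1"
  proof -
    have "norm2_vec (unit_vec n j) = sqrt (\<Sum>i\<in>{0..<n}. if i = j then 1 else 0)"
      unfolding norm2_vec_def L2_set_def using \<open>j < n\<close>
      by (intro arg_cong[of _ _ sqrt] sum.cong) auto
    then show ?thesis using \<open>j < n\<close> by simp
  qed
  have "\<bar>vec_index (A *\<^sub>v unit_vec n j) i\<bar> \<le> norm2_vec (A *\<^sub>v unit_vec n j)"
    using A \<open>i < m\<close> by (intro abs_vec_index_le_norm2_vec) simp
  also have "\<dots> \<le> norm2_mat A"
    using norm2_mult_mat_vec_le[OF A, of "unit_vec n j"] e by simp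
  finally show ?thesis using A assms(2,3) by simp
qed

lemma norm2_mat_nonneg:
  assumes "A \<in> carrier_mat n n" "0 < n"
  shows "0 \<le> norm2_mat A"
  using abs_entry_le_norm2_mat[OF assms(1), of 0 0] assms(2) abs_ge_zero order_trans by blast

lemma adams_beta_first_lag_pos:
  assumes "1 \<le> M"
  shows "0 < adams_beta s M (first_lag s)"
proof (cases s)
  case AB
  have "0 < integral {0..1} (\<lambda>u. \<Prod>i\<in>{0..M - 1} - {0}. u + real i)"
    by (rule integral_pos_if_pos_at_point[of _ 1]) (auto intro!: continuous_intros prod_nonneg prod_pos)
  then show ?thesis using AB assms by simp
next
  case AM
  have "0 < integral {0..1} (\<lambda>u. \<Prod>i\<in>{0..M} - {0}. u + real i - 1)"
    by (rule integral_pos_if_pos_at_point[of _ 1]) (auto intro!: continuous_intros prod_nonneg prod_pos)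
  then show ?thesis using AM assms by simp
qed

lemma A_mat_carrier:
  assumes "1 \<le> M" "M \<le> N"
  shows "A_mat s M N \<in> carrier_mat (num_unknowns s N) (num_unknowns s N)"
  unfolding A_mat_def num_aux_eq(2)[OF assms, of s]
  by (rule carrier_append_rows) (simp_all add: B_aux_def B_mat_def num_aux_eq(2)[OF assms, of s])

lemma A_mat_entry:
  assumes "1 \<le> M" "M \<le> N" "i < num_unknowns s N" "j < num_unknowns s N"
  shows "A_mat s M N $$ (i, j) =
    (if i < num_aux s M then (if j = i then 1 else 0)
     else if j \<le> i + first_lag s then adams_beta s M (i + first_lag s - j) else 0)"
proof -
  have *: "i - num_aux s M + M = i + first_lag s" if "\<not> i < num_aux s M"
    using that assms(1) by (cases s) auto
  have "i - num_aux s M < N - M + 1" if "\<not> i < num_aux s M"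
    using that assms(3) num_aux_eq(2)[OF assms(1,2), of s] by linarith
  then show ?thesis
    using assms * num_aux_eq(2)[OF assms(1,2), of s]
    by (auto simp: A_mat_def append_rows_def B_aux_def B_mat_def)
qed

text \<open>
The matrix is lower triangular with diagonal entries \<open>1\<close> and the leading weight of the scheme,
which is positive as the integral of a nonnegative polynomial.
\<close>

lemma A_mat_inverse:
  fixes s :: adams
  assumes "1 \<le> M" "M \<le> N"
  defines "t \<equiv> num_unknowns s N"
  defines "Ai \<equiv> the (mat_inverse (A_mat s M N))"
  shows "Ai \<in> carrier_mat t t" "Ai * A_mat s M N = 1\<^sub>m t"
proof -
  let ?A = "A_mat s M N"
  have A: "?A \<in> carrier_mat t t" unfolding t_def by (rule A_mat_carrier[OF assms(1,2)])
  note entry = A_mat_entry[OF assms(1,2), where s = s, folded t_def]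
  have "?A $$ (i, j) = 0" if "i < j" "j < t" for i j
  proof (cases "j \<le> i + first_lag s")
    case True
    then have "s = AB" "i + first_lag s - j = 0" using that by (cases s; simp)+
    then show ?thesis using that entry[of i j] by simp
  qed (use that entry[of i j] in simp)
  then have "det ?A = prod_list (diag_mat ?A)"
    by (rule det_lower_triangular[OF _ A])
  also have "\<dots> = (\<Prod>i = 0..<t. ?A $$ (i, i))"
    using A by (simp add: prod_list_diag_prod)
  also have "\<dots> \<noteq> 0"
    using adams_beta_first_lag_pos[OF assms(1), of s]
    by (simp add: entry)
  finally have "?A \<in> Units (ring_mat TYPE(real) t ())"
    by (rule det_non_zero_imp_unit[OF A])
  then obtain B where "mat_inverse ?A = Some B"
    using mat_inverse(1)[OF A, where b = "()"] by (cases "mat_inverse ?A") auto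
  with mat_inverse(2)[OF A this] show "Ai \<in> carrier_mat t t" "Ai * ?A = 1\<^sub>m t"
    by (simp_all add: Ai_def)
qed

text \<open>
This lower bound lets the truncation error, which enters without a factor \<open>norm2_mat A\<close>, be
absorbed into the condition number. The corner entry is \<open>1\<close>: it belongs to an auxiliary condition,
except for the one-step explicit scheme, whose single weight is \<open>1\<close>.
\<close>

lemma one_le_norm2_A_mat:
  assumes "1 \<le> M" "M \<le> N"
  shows "1 \<le> norm2_mat (A_mat s M N)"
proof -
  have t: "0 < num_unknowns s N" by (simp add: num_unknowns_def)
  have "A_mat s M N $$ (0, 0) = 1"
  proof (cases "num_aux s M = 0")
    case True
    then have "s = AB" "M = 1" using assms(1) by (cases s; simp)+
    then show ?thesis
      using A_mat_entry[OF assms t t] by simp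
  qed (simp add: A_mat_entry[OF assms t t])
  then show ?thesis
    using abs_entry_le_norm2_mat[OF A_mat_carrier[OF assms] t t] by simp
qed

lemma norm2_vec_le_cond2:
  assumes "1 \<le> M" "M \<le> N" and v: "v \<in> carrier_vec (num_unknowns s N)"
    and "0 \<le> b" "norm2_vec (A_mat s M N *\<^sub>v v) \<le> norm2_mat (A_mat s M N) * a + b"
  shows "norm2_vec v \<le> cond2 (A_mat s M N) * (a + b)"
proof -
  let ?A = "A_mat s M N" and ?t = "num_unknowns s N"
  let ?Ai = "the (mat_inverse ?A)"
  note A = A_mat_carrier[OF assms(1,2), of s] and Ai = A_mat_inverse[OF assms(1,2), of s]
  have t: "0 < ?t" by (simp add: num_unknowns_def)
  have "v = ?Ai *\<^sub>v (?A *\<^sub>v v)"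
    using assoc_mult_mat_vec[OF Ai(1) A v] Ai(2) v by simp
  then have "norm2_vec v \<le> norm2_mat ?Ai * norm2_vec (?A *\<^sub>v v)"
    using norm2_mult_mat_vec_le[OF Ai(1), of "?A *\<^sub>v v"] A v by simp
  also have "\<dots> \<le> norm2_mat ?Ai * (norm2_mat ?A * (a + b))"
  proof (rule mult_left_mono)
    have "1 * b \<le> norm2_mat ?A * b"
      using one_le_norm2_A_mat[OF assms(1,2), of s] \<open>0 \<le> b\<close> by (intro mult_right_mono)
    then show "norm2_vec (?A *\<^sub>v v) \<le> norm2_mat ?A * (a + b)"
      using assms(5) by (simp add: distrib_left)
  qed (rule norm2_mat_nonneg[OF Ai(1) t])
  finally show ?thesis by (simp add: cond2_def mult_ac)
qed

section \<open>Error estimate for the discovered dynamics\<close>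

text \<open>
Finitely many initial terms are absorbed by enlarging the constant; the final estimate concerns
every admissible \<open>N\<close>, not only large ones.
\<close>

lemma bigo_bound_from_1:
  fixes u g :: "nat \<Rightarrow> real"
  assumes "u \<in> O(g)" and g: "\<And>N. 1 \<le> N \<Longrightarrow> 0 < g N"
  obtains c where "0 \<le> c" "\<And>N. 1 \<le> N \<Longrightarrow> \<bar>u N\<bar> \<le> c * g N"
proof -
  obtain c where c: "0 < c" "eventually (\<lambda>N. norm (u N) \<le> c * norm (g N)) sequentially"
    using assms(1) by (rule landau_o.bigE)
  then obtain N0 where N0: "\<And>N. N0 \<le> N \<Longrightarrow> norm (u N) \<le> c * norm (g N)"
    unfolding eventually_sequentially by blast
  let ?q = "\<lambda>N. \<bar>u N\<bar> / \<bar>g N\<bar>"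
  show thesis
  proof (rule that)
    show "0 \<le> c + (\<Sum>N<N0. ?q N)" using c(1) by (intro add_nonneg_nonneg sum_nonneg) auto
    fix N :: nat assume N: "1 \<le> N"
    have "?q N \<le> c + (\<Sum>N<N0. ?q N)"
    proof (cases "N < N0")
      case True
      then have "?q N \<le> (\<Sum>N<N0. ?q N)" by (intro member_le_sum) auto
      then show ?thesis using c(1) by linarith
    next
      case False
      then have "?q N \<le> c" using N0[of N] g[OF N] by (simp add: divide_le_eq)
      moreover have "0 \<le> (\<Sum>N<N0. ?q N)" by (intro sum_nonneg) simp
      ultimately show ?thesis by linarith
    qed
    then show "\<bar>u N\<bar> \<le> (c + (\<Sum>N<N0. ?q N)) * g N"
      using g[OF N] by (simp add: divide_le_eq)
  qed
qed

lemma discovery_residual_le: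
  assumes "1 \<le> M" "M \<le> N" "0 \<le> D"
    and aux: "\<And>r. r < num_aux s M \<Longrightarrow> \<bar>one_sided_diff T y \<gamma> (adams_order s M) N r - \<phi> (grid T N r)\<bar> \<le> D"
    and scheme: "\<And>n. M \<le> n \<Longrightarrow> n \<le> N \<Longrightarrow>
      \<bar>(\<Sum>m = 0..M. adams_alpha m * y (grid T N (n - m))) / step T N
        - (\<Sum>m\<in>{first_lag s..M}. adams_beta s M m * \<phi> (grid T N (n - m)))\<bar> \<le> D"
  shows "norm2_vec (A_mat s M N *\<^sub>v Matrix.vec (num_unknowns s N) (\<lambda>n. \<phi> (grid T N n)) - d_vec s T y \<gamma> M N)
    \<le> sqrt (real (num_unknowns s N)) * D"
proof (rule norm2_vec_le_sqrt_dim)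
  let ?t = "num_unknowns s N" and ?a = "num_aux s M"
  let ?v = "Matrix.vec ?t (\<lambda>n. \<phi> (grid T N n))"
  note t = num_aux_eq(2)[OF assms(1,2), of s]
  have d: "d_vec s T y \<gamma> M N \<in> carrier_vec ?t"
    unfolding d_vec_def t by (intro append_carrier_vec) (simp_all add: c_vec_def q_vec_def)
  then show "A_mat s M N *\<^sub>v ?v - d_vec s T y \<gamma> M N \<in> carrier_vec ?t"
    using A_mat_carrier[OF assms(1,2), of s] by auto
  fix k assume k: "k < ?t"
  have split: "A_mat s M N *\<^sub>v ?v = (B_aux s M N *\<^sub>v ?v) @\<^sub>v (B_mat s M N *\<^sub>v ?v)"
    unfolding A_mat_def
    by (rule mat_mult_append[of _ ?a _ _ "N - M + 1"]) (simp_all add: B_aux_def B_mat_def)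
  have dims: "dim_vec (B_aux s M N *\<^sub>v ?v) = ?a" "dim_vec (B_mat s M N *\<^sub>v ?v) = N - M + 1"
    "dim_vec (c_vec s T y \<gamma> M N) = ?a" "dim_vec (q_vec T y M N) = N - M + 1"
    by (simp_all add: B_aux_def B_mat_def c_vec_def q_vec_def)
  have kt: "k < ?a + (N - M + 1)" using k unfolding t .
  have minus: "vec_index (A_mat s M N *\<^sub>v ?v - d_vec s T y \<gamma> M N) k
      = vec_index (A_mat s M N *\<^sub>v ?v) k - vec_index (d_vec s T y \<gamma> M N) k"
    using k d by (intro index_minus_vec) simp
  have append: "vec_index (v1 @\<^sub>v v2) k = (if k < ?a then vec_index v1 k else vec_index v2 (k - ?a))"
    if "dim_vec v1 = ?a" "dim_vec v2 = N - M + 1" for v1 v2 :: "real Matrix.vec"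
    using kt that by simp
  have rows: "vec_index (A_mat s M N *\<^sub>v ?v - d_vec s T y \<gamma> M N) k =
    (if k < ?a then vec_index (B_aux s M N *\<^sub>v ?v) k - vec_index (c_vec s T y \<gamma> M N) k
     else vec_index (B_mat s M N *\<^sub>v ?v) (k - ?a) - vec_index (q_vec T y M N) (k - ?a))"
    unfolding minus unfolding split d_vec_def append[OF dims(1,2)] append[OF dims(3,4)]
    by (cases "k < ?a") (simp_all only: if_True if_False)
  show "\<bar>vec_index (A_mat s M N *\<^sub>v ?v - d_vec s T y \<gamma> M N) k\<bar> \<le> D"
  proof (cases "k < ?a")
    case True
    have "vec_index (B_aux s M N *\<^sub>v ?v) k = (\<Sum>j\<in>{0..<?t}. (if j = k then 1 else 0) * \<phi> (grid T N j))"
      using True by (auto simp: B_aux_def scalar_prod_def intro!: sum.cong)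
    also have "\<dots> = (\<Sum>j\<in>{0..<?t}. if j = k then \<phi> (grid T N j) else 0)"
      by (intro sum.cong) auto
    also have "\<dots> = \<phi> (grid T N k)" using k by simp
    finally have "vec_index (A_mat s M N *\<^sub>v ?v - d_vec s T y \<gamma> M N) k =
        \<phi> (grid T N k) - one_sided_diff T y \<gamma> (adams_order s M) N k"
      unfolding rows using True by (simp add: c_vec_def)
    then show ?thesis using aux[OF True] by (simp add: abs_minus_commute)
  next
    case False
    define n where "n = k - ?a + M"
    have n: "M \<le> n" "n \<le> N" "k - ?a = n - M" "n - M < N - M + 1"
      using False k t assms(2) by (auto simp: n_def)
    have "vec_index (B_mat s M N *\<^sub>v ?v) (n - M)
        = (\<Sum>m\<in>{first_lag s..M}. adams_beta s M m * vec_index ?v (n - m))"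
      using n assms(1) by (intro B_mat_mult) auto
    also have "\<dots> = (\<Sum>m\<in>{first_lag s..M}. adams_beta s M m * \<phi> (grid T N (n - m)))"
      using n assms(1) by (cases s; intro sum.cong) (auto simp: num_unknowns_def)
    finally have "vec_index (A_mat s M N *\<^sub>v ?v - d_vec s T y \<gamma> M N) k =
      (\<Sum>m\<in>{first_lag s..M}. adams_beta s M m * \<phi> (grid T N (n - m))) -
      (\<Sum>m = 0..M. adams_alpha m * y (grid T N (n - m))) / step T N"
      unfolding rows using False n by (simp add: q_vec_def)
    then show ?thesis using scheme[OF n(1,2)] by (simp add: abs_minus_commute)
  qed
qed (rule \<open>0 \<le> D\<close>)

text \<open>
The residual of a minimiser is at most that of the competitor \<open>u\<close>, which is near the true values
\<open>v\<close> and therefore has residual at most \<open>norm2_mat A * a + b\<close>. Adding the residual of \<open>v\<close> bounds the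
image of the error under \<open>A\<close>; inverting \<open>A\<close> produces the condition number.
\<close>

lemma minimizer_error_le_cond2:
  fixes s M N
  defines "t \<equiv> num_unknowns s N" and "A \<equiv> A_mat s M N"
  assumes "1 \<le> M" "M \<le> N" and carrier: "vh \<in> carrier_vec t" "v \<in> carrier_vec t" "u \<in> carrier_vec t" "d \<in> carrier_vec t"
    and minimal: "norm2_vec (A *\<^sub>v vh - d) \<le> norm2_vec (A *\<^sub>v u - d)"
    and consistent: "norm2_vec (A *\<^sub>v v - d) \<le> b"
    and near: "norm2_vec (u - v) \<le> a"
  shows "norm2_vec (vh - v) \<le> cond2 A * (a + 2 * b)"
proof -
  have A: "A \<in> carrier_mat t t" unfolding A_def t_def by (rule A_mat_carrier[OF assms(3,4)])
  have "0 \<le> b" using norm2_vec_nonneg consistent by (rule order_trans)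
  have Av: "A *\<^sub>v w \<in> carrier_vec t" if "w \<in> carrier_vec t" for w
    using A that by simp
  have cancel: "(a - c) - (b - c) = a - b" "(a - b) + (b - c) = a - c"
    if "a \<in> carrier_vec t" "b \<in> carrier_vec t" "c \<in> carrier_vec t" for a b c :: "real Matrix.vec"
    by (rule eq_vecI; use that in simp)+
  have diff: "w - w' \<in> carrier_vec t" if "w \<in> carrier_vec t" "w' \<in> carrier_vec t" for w w' :: "real Matrix.vec"
    using that by simp
  have "A *\<^sub>v (vh - v) = (A *\<^sub>v vh - d) - (A *\<^sub>v v - d)"
    unfolding mult_minus_distrib_mat_vec[OF A carrier(1,2)]
    by (rule cancel(1)[OF Av[OF carrier(1)] Av[OF carrier(2)] carrier(4), symmetric])
  then have "norm2_vec (A *\<^sub>v (vh - v)) \<le> norm2_vec (A *\<^sub>v vh - d) + norm2_vec (A *\<^sub>v v - d)"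
    by (simp only: norm2_vec_minus_le[OF diff[OF Av[OF carrier(1)] carrier(4)] diff[OF Av[OF carrier(2)] carrier(4)]])
  also have "\<dots> \<le> norm2_vec (A *\<^sub>v u - d) + b"
    by (intro add_mono minimal consistent)
  also have "A *\<^sub>v u - d = A *\<^sub>v (u - v) + (A *\<^sub>v v - d)"
    unfolding mult_minus_distrib_mat_vec[OF A carrier(3,2)]
    by (rule cancel(2)[OF Av[OF carrier(3)] Av[OF carrier(2)] carrier(4), symmetric])
  also have "norm2_vec (A *\<^sub>v (u - v) + (A *\<^sub>v v - d)) \<le> norm2_vec (A *\<^sub>v (u - v)) + norm2_vec (A *\<^sub>v v - d)"
    by (rule norm2_vec_add_le[OF Av[OF diff[OF carrier(3,2)]] diff[OF Av[OF carrier(2)] carrier(4)]])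
  also have "\<dots> \<le> norm2_mat A * norm2_vec (u - v) + b"
    by (intro add_mono consistent norm2_mult_mat_vec_le[OF A] diff carrier)
  also have "\<dots> \<le> norm2_mat A * a + b"
    using near one_le_norm2_A_mat[OF assms(3,4), of s]
    by (intro add_mono mult_left_mono) (auto simp: A_def)
  finally have "norm2_vec (A *\<^sub>v (vh - v)) \<le> norm2_mat A * a + 2 * b" by simp
  with \<open>0 \<le> b\<close> carrier show ?thesis
    unfolding A_def t_def by (intro norm2_vec_le_cond2[OF assms(3,4)]) auto
qed

theorem theorem4p2:
  fixes s :: adams and M :: nat and T :: real
    and F :: "real^'d \<Rightarrow> real^'d" and x :: "real \<Rightarrow> real^'d" and x_init :: "real^'d"
    and \<Omega> :: "(real^'d) set" and i :: 'd and f :: "real^'d \<Rightarrow> real"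
    and \<gamma> :: "nat \<Rightarrow> real" and p :: nat
  assumes "1 \<le> M" and p: "p = adams_order s M"
    and "0 < T"
    and ode: "\<forall>t\<in>{0..T}. (x has_vector_derivative F (x t)) (at t within {0..T})"
    and init: "x 0 = x_init"
    and smooth: "smooth_on_interval 0 T x"
    and nbhd: "x ` {0..T} \<subseteq> interior \<Omega>"
    and f: "f = (\<lambda>z. F z $ i)"
    and fd: "\<forall>r < num_aux s M.
      (\<lambda>N. one_sided_diff T (\<lambda>t. x t $ i) \<gamma> p N r - f (x (grid T N r)))
        \<in> O(\<lambda>N. step T N ^ p)"
  shows "\<exists>C > 0. \<forall>\<A> R. \<A> \<subseteq> {u. continuous_on \<Omega> u} \<and> 0 < R \<longrightarrow>
    (\<forall>N fhat e. enough_samples s M N \<and>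
       is_arg_min (aux_loss s T x i \<gamma> M N) (\<lambda>u. u \<in> \<A>) fhat \<and>
       fhat \<in> trace_class p T x f \<A> R \<and>
       ereal e > (INF u\<in>\<A>. SUP z\<in>\<Omega>. ereal \<bar>u z - f z\<bar>) \<longrightarrow>
       integral {0..T} (\<lambda>t. \<bar>fhat (x t) - f (x t)\<bar>)
         \<le> C * (cond2 (A_mat s M N) * (step T N ^ p + e) + R * step T N ^ p))"
proof -
  have "1 \<le> p" using \<open>1 \<le> M\<close> p by (cases s) auto
  let ?y = "\<lambda>t. x t $ i"
  have x_in: "x t \<in> \<Omega>" if "t \<in> {0..T}" for t
    using nbhd that interior_subset by blast
  have grid_in: "grid T N n \<in> {0..T}" if "1 \<le> N" "n \<le> N" for N n
    using that \<open>0 < T\<close> by (simp add: grid_def step_def field_simps)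
  have step_pos: "0 < step T N" if "1 \<le> N" for N
    using that \<open>0 < T\<close> by (simp add: step_def)
  obtain X where X: "X 0 = x"
    "\<And>k t. t \<in> {0..T} \<Longrightarrow> (X k has_vector_derivative X (Suc k) t) (at t within {0..T})"
    using smooth unfolding smooth_on_interval_def by blast
  define Y where "Y k t = X (Suc k) t $ i" for k t
  have component: "((\<lambda>t. X k t $ i) has_vector_derivative X (Suc k) t $ i) (at t within {0..T})"
    if "t \<in> {0..T}" for k t
    by (rule bounded_linear.has_vector_derivative[OF bounded_linear_vec_nth X(2)[OF that]])
  have y: "(?y has_vector_derivative Y 0 t) (at t within {0..T})" if "t \<in> {0..T}" for t
    using component[OF that, of 0] by (simp add: Y_def X(1))
  have Y: "(Y k has_vector_derivative Y (Suc k) t) (at t within {0..T})" if "t \<in> {0..T}" for k t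
    using component[OF that, of "Suc k"] by (simp add: Y_def[abs_def])
  have f_eq: "f (x t) = Y 0 t" if t: "t \<in> {0..T}" for t
  proof -
    have "(?y has_vector_derivative f (x t)) (at t within {0..T})"
      unfolding f using ode t by (intro bounded_linear.has_vector_derivative[OF bounded_linear_vec_nth]) auto
    then show ?thesis
      using vector_derivative_within_closed_interval[OF \<open>0 < T\<close> t] y[OF t] by metis
  qed
  have cont_x: "continuous_on {0..T} x"
    using ode by (intro continuous_on_vector_derivative) blast
  have cont_Y: "continuous_on {0..T} (Y 0)"
    by (rule continuous_on_vector_derivative[OF Y])
  obtain C1 where C1: "0 \<le> C1" "\<And>n N. M \<le> n \<Longrightarrow> n \<le> N \<Longrightarrow>
      \<bar>(\<Sum>m = 0..M. adams_alpha m * ?y (grid T N (n - m))) / step T N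
        - (\<Sum>m\<in>{first_lag s..M}. adams_beta s M m * Y 0 (grid T N (n - m)))\<bar>
      \<le> C1 * step T N ^ p"
    by (rule adams_truncation_error[of M T ?y Y s, OF \<open>1 \<le> M\<close> \<open>0 < T\<close> y Y])
      (assumption, assumption, rule that, auto simp: p)
  have "\<exists>c. 0 \<le> c \<and> (\<forall>N\<ge>1. \<bar>one_sided_diff T ?y \<gamma> p N r - f (x (grid T N r))\<bar> \<le> c * step T N ^ p)"
    if "r < num_aux s M" for r
  proof -
    have "(\<lambda>N. one_sided_diff T ?y \<gamma> p N r - f (x (grid T N r))) \<in> O(\<lambda>N. step T N ^ p)"
      using fd that by blast
    then obtain c where "0 \<le> c" "\<And>N. 1 \<le> N \<Longrightarrow> \<bar>one_sided_diff T ?y \<gamma> p N r - f (x (grid T N r))\<bar> \<le> c * step T N ^ p"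
      by (rule bigo_bound_from_1) (auto simp: step_pos)
    then show ?thesis by blast
  qed
  then obtain c where c: "\<And>r. r < num_aux s M \<Longrightarrow> 0 \<le> c r"
    "\<And>r N. r < num_aux s M \<Longrightarrow> 1 \<le> N \<Longrightarrow>
      \<bar>one_sided_diff T ?y \<gamma> p N r - f (x (grid T N r))\<bar> \<le> c r * step T N ^ p"
    by metis
  \<comment> \<open>One constant for the residual in all rows; the number of auxiliary rows does not depend on \<open>N\<close>.\<close>
  define D where "D = C1 + (\<Sum>r<num_aux s M. c r)"
  have sum_c: "0 \<le> (\<Sum>r<num_aux s M. c r)" using c(1) by (intro sum_nonneg) auto
  have "0 \<le> D" "C1 \<le> D" using C1(1) sum_c by (auto simp: D_def)
  have c_le_D: "c r \<le> D" if "r < num_aux s M" for r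
  proof -
    have "c r \<le> (\<Sum>r<num_aux s M. c r)" using that c(1) by (intro member_le_sum) auto
    then show ?thesis using C1(1) by (simp add: D_def)
  qed
  define K1 where "K1 = 2 * real p * real p ^ p"
  define K2 where "K2 = 2 * real p * (1 + real p * real p ^ p) * real p ^ (p - 1)"
  have "0 \<le> K1" "0 \<le> K2" by (simp_all add: K1_def K2_def)
  \<comment> \<open>The first part multiplies the condition number, the second one \<open>R\<close>; the summand \<open>1\<close> only makes
    \<open>C\<close> positive.\<close>
  define C where "C = K1 * (2 * T) * (1 + 2 * D) + K2 * sqrt T + 1"
  have "0 < C" using \<open>0 \<le> K1\<close> \<open>0 \<le> K2\<close> \<open>0 \<le> D\<close> \<open>0 < T\<close>
    unfolding C_def by (intro add_nonneg_pos add_nonneg_nonneg mult_nonneg_nonneg) auto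
  have main: "integral {0..T} (\<lambda>t. \<bar>fhat (x t) - f (x t)\<bar>)
         \<le> C * (cond2 (A_mat s M N) * (step T N ^ p + e) + R * step T N ^ p)"
    if A: "\<A> \<subseteq> {u. continuous_on \<Omega> u}" and "0 < R" and enough: "enough_samples s M N"
      and argmin: "is_arg_min (aux_loss s T x i \<gamma> M N) (\<lambda>u. u \<in> \<A>) fhat"
      and trace: "fhat \<in> trace_class p T x f \<A> R"
      and e: "ereal e > (INF u\<in>\<A>. SUP z\<in>\<Omega>. ereal \<bar>u z - f z\<bar>)"
    for \<A> R N fhat e
  proof -
    have N: "M \<le> N" "1 \<le> N" using enough \<open>1 \<le> M\<close> by (auto simp: enough_samples_def)
    define h where "h = step T N"
    have "0 < h" using step_pos[OF N(2)] by (simp add: h_def)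
    let ?t = "num_unknowns s N" and ?A = "A_mat s M N" and ?d = "d_vec s T ?y \<gamma> M N"
    let ?S = "sample_vec s T x N"
    have t: "?t = Suc (last_index s N)" "?t \<le> Suc N" by (cases s; simp add: num_unknowns_def)+
    have grid_t: "grid T N n \<in> {0..T}" if "n < ?t" for n
      using that t(2) N(2) by (intro grid_in) auto
    have carrier: "?S u \<in> carrier_vec ?t" for u by (simp add: sample_vec_def)
    have d: "?d \<in> carrier_vec ?t"
      unfolding d_vec_def num_aux_eq(2)[OF \<open>1 \<le> M\<close> N(1), of s]
      by (intro append_carrier_vec) (simp_all add: c_vec_def q_vec_def)
    obtain u where u: "u \<in> \<A>" "\<And>z. z \<in> \<Omega> \<Longrightarrow> \<bar>u z - f z\<bar> \<le> e"
    proof -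
      from e obtain u where "u \<in> \<A>" and sup: "(SUP z\<in>\<Omega>. ereal \<bar>u z - f z\<bar>) < ereal e"
        unfolding INF_less_iff by blast
      moreover have "\<bar>u z - f z\<bar> \<le> e" if "z \<in> \<Omega>" for z
        using SUP_upper[OF that, of "\<lambda>z. ereal \<bar>u z - f z\<bar>"] sup by (simp add: order_trans less_imp_le flip: ereal_less_eq(3))
      ultimately show thesis using that by blast
    qed
    have "0 \<le> e" using u(2)[OF x_in[of 0]] \<open>0 < T\<close> by (auto intro: order_trans[OF abs_ge_zero])
    have residual: "norm2_vec (?A *\<^sub>v ?S f - ?d) \<le> sqrt (real ?t) * (D * h ^ p)"
    proof -
      have "norm2_vec (?A *\<^sub>v Matrix.vec ?t (\<lambda>n. f (x (grid T N n))) - ?d) \<le> sqrt (real ?t) * (D * h ^ p)"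
      proof (rule discovery_residual_le[OF \<open>1 \<le> M\<close> N(1), where \<phi> = "\<lambda>t. f (x t)"])
        show "0 \<le> D * h ^ p" using \<open>0 \<le> D\<close> \<open>0 < h\<close> by simp
        show "\<bar>one_sided_diff T ?y \<gamma> (adams_order s M) N r - f (x (grid T N r))\<bar> \<le> D * h ^ p"
          if "r < num_aux s M" for r
          using order_trans[OF c(2)[OF that N(2)] mult_right_mono[OF c_le_D[OF that]]] \<open>0 < h\<close>
          by (simp add: p h_def)
        show "\<bar>(\<Sum>m = 0..M. adams_alpha m * ?y (grid T N (n - m))) / step T N
            - (\<Sum>m\<in>{first_lag s..M}. adams_beta s M m * f (x (grid T N (n - m))))\<bar> \<le> D * h ^ p"
          if "M \<le> n" "n \<le> N" for n
        proof -
          have "(\<Sum>m\<in>{first_lag s..M}. adams_beta s M m * f (x (grid T N (n - m))))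
              = (\<Sum>m\<in>{first_lag s..M}. adams_beta s M m * Y 0 (grid T N (n - m)))"
          proof (intro sum.cong refl)
            fix m
            have "grid T N (n - m) \<in> {0..T}" using N that by (intro grid_in) auto
            from f_eq[OF this] show "adams_beta s M m * f (x (grid T N (n - m))) = adams_beta s M m * Y 0 (grid T N (n - m))"
              by (rule arg_cong)
          qed
          moreover have "C1 * h ^ p \<le> D * h ^ p"
            using \<open>C1 \<le> D\<close> \<open>0 < h\<close> by (intro mult_right_mono) auto
          ultimately show ?thesis using C1(2)[OF that] by (simp only: h_def[symmetric])
        qed
      qed
      then show ?thesis by (simp add: sample_vec_def)
    qed
    have near: "norm2_vec (?S u - ?S f) \<le> sqrt (real ?t) * e"
    proof (rule norm2_vec_le_sqrt_dim[OF _ _ \<open>0 \<le> e\<close>])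
      show "?S u - ?S f \<in> carrier_vec ?t" using carrier by simp
      fix n assume n: "n < ?t"
      then have "vec_index (?S u - ?S f) n = u (x (grid T N n)) - f (x (grid T N n))"
        by (simp add: sample_vec_def)
      then show "\<bar>vec_index (?S u - ?S f) n\<bar> \<le> e"
        using u(2)[OF x_in[OF grid_t[OF n]]] by simp
    qed
    have minimal: "norm2_vec (?A *\<^sub>v ?S fhat - ?d) \<le> norm2_vec (?A *\<^sub>v ?S u - ?d)"
    proof -
      have "aux_loss s T x i \<gamma> M N fhat \<le> aux_loss s T x i \<gamma> M N u"
        using argmin u(1) unfolding is_arg_min_def by (meson not_le)
      then have "(norm2_vec (?A *\<^sub>v ?S fhat - ?d))\<^sup>2 \<le> (norm2_vec (?A *\<^sub>v ?S u - ?d))\<^sup>2"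
        using t(1) by (simp add: aux_loss_def divide_le_cancel)
      then show ?thesis by (rule power2_le_imp_le) (rule norm2_vec_nonneg)
    qed
    let ?\<kappa> = "cond2 ?A"
    have "norm2_vec (?S fhat - ?S f) \<le> ?\<kappa> * (sqrt (real ?t) * e + 2 * (sqrt (real ?t) * (D * h ^ p)))"
      by (rule minimizer_error_le_cond2[OF \<open>1 \<le> M\<close> N(1) carrier carrier carrier d minimal residual near])
    also have "\<dots> = sqrt (real ?t) * (?\<kappa> * (e + 2 * D * h ^ p))"
      by (simp add: algebra_simps)
    finally have vec_err: "norm2_vec (?S fhat - ?S f) \<le> sqrt (real ?t) * (?\<kappa> * (e + 2 * D * h ^ p))" .
    define g where "g t = fhat (x t) - f (x t)" for t
    have "(\<Sum>m\<le>last_index s N. \<bar>g (real m * (T / real N))\<bar>) = (\<Sum>m<?t. \<bar>vec_index (?S fhat - ?S f) m\<bar>)"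
      unfolding t(1) lessThan_Suc_atMost
      by (intro sum.cong refl) (simp add: sample_vec_def g_def grid_def step_def t(1))
    also have "\<dots> \<le> sqrt (real ?t) * norm2_vec (?S fhat - ?S f)"
      by (rule sum_abs_le_sqrt_dim_norm2_vec) (use carrier in simp)
    also have "\<dots> \<le> sqrt (real ?t) * (sqrt (real ?t) * (?\<kappa> * (e + 2 * D * h ^ p)))"
      by (intro mult_left_mono vec_err) simp
    also have "\<dots> = real ?t * (?\<kappa> * (e + 2 * D * h ^ p))"
      by (simp flip: mult.assoc)
    finally have samples: "(\<Sum>m\<le>last_index s N. \<bar>g (real m * (T / real N))\<bar>) \<le> real ?t * (?\<kappa> * (e + 2 * D * h ^ p))" .
    have "0 \<le> ?\<kappa>"
      unfolding cond2_def
      using norm2_mat_nonneg[OF A_mat_carrier[OF \<open>1 \<le> M\<close> N(1), of s]]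
        norm2_mat_nonneg[OF A_mat_inverse(1)[OF \<open>1 \<le> M\<close> N(1), of s]] t(1)
      by (intro mult_nonneg_nonneg) auto
    \<comment> \<open>There may be \<open>N + 1\<close> samples, whence the factor \<open>2\<close>.\<close>
    have ht: "h * real ?t \<le> 2 * T"
    proof -
      have "real ?t \<le> 2 * real N" using t(2) N(2) by linarith
      then have "h * real ?t \<le> h * (2 * real N)" using \<open>0 < h\<close> by (intro mult_left_mono) auto
      also have "\<dots> = 2 * T" using N(2) by (simp add: h_def step_def)
      finally show ?thesis .
    qed
    from trace have fhat: "fhat \<in> \<A>" and gH: "g \<in> sobolev_H p 0 T" and gR: "sobolev_seminorm p 0 T g \<le> R"
      unfolding trace_class_def g_def[abs_def] by auto
    \<comment> \<open>The weak derivative to which the seminorm refers.\<close>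
    define w where "w = (SOME w. square_integrable 0 T w \<and> weak_derivative 0 T p g w)"
    have "\<exists>w. square_integrable 0 T w \<and> weak_derivative 0 T p g w"
      using gH \<open>1 \<le> p\<close> unfolding sobolev_H_def by auto
    then have "square_integrable 0 T w \<and> weak_derivative 0 T p g w"
      unfolding w_def by (rule someI_ex)
    then have w: "square_integrable 0 T w" "weak_derivative 0 T p g w" by simp_all
    have "(LINT t|lebesgue_on {0<..<T}. \<bar>w t\<bar>) \<le> sqrt T * L2_norm 0 T w"
      by (rule L1_le_L2_norm[OF \<open>0 < T\<close> w(1)])
    also have "\<dots> \<le> sqrt T * R"
      using gR \<open>0 < T\<close> unfolding sobolev_seminorm_def w_def by (intro mult_left_mono) auto
    finally have wR: "(LINT t|lebesgue_on {0<..<T}. \<bar>w t\<bar>) \<le> sqrt T * R" .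
    have "continuous_on {0..T} (\<lambda>t. fhat (x t) - Y 0 t)"
      using fhat A x_in by (intro continuous_intros cont_Y continuous_on_compose2[OF _ cont_x]) auto
    then have cont_g: "continuous_on {0..T} g"
      by (rule continuous_on_eq) (simp add: g_def f_eq)
    have "integral {0..T} (\<lambda>t. \<bar>g t\<bar>) \<le>
      K1 * ((T / real N) * (\<Sum>m\<le>last_index s N. \<bar>g (real m * (T / real N))\<bar>))
      + K2 * ((T / real N) ^ p * (LINT t|lebesgue_on {0<..<T}. \<bar>w t\<bar>))"
      unfolding K1_def K2_def
    proof (rule sampling_inequality[OF \<open>1 \<le> p\<close> \<open>0 < T\<close> N(2) _ _ _ cont_g w(2) square_integrable_imp_integrable[OF w(1)]])
      show "p \<le> Suc (last_index s N)" "N \<le> Suc (last_index s N)" "last_index s N \<le> N"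
        using N p by (cases s; simp)+
    qed
    also have "\<dots> \<le> K1 * (h * (real ?t * (?\<kappa> * (e + 2 * D * h ^ p)))) + K2 * (h ^ p * (sqrt T * R))"
      unfolding h_def step_def[symmetric]
      using samples wR \<open>0 \<le> K1\<close> \<open>0 \<le> K2\<close> step_pos[OF N(2)]
      by (intro add_mono mult_left_mono) (auto simp: h_def step_def)
    also have "\<dots> \<le> K1 * (2 * T * ((1 + 2 * D) * (?\<kappa> * (h ^ p + e)))) + K2 * (h ^ p * (sqrt T * R))"
    proof (rule add_right_mono, rule mult_left_mono[OF _ \<open>0 \<le> K1\<close>])
      have "?\<kappa> * (e + 2 * D * h ^ p) \<le> ?\<kappa> * ((1 + 2 * D) * (h ^ p + e))"
        using \<open>0 \<le> ?\<kappa>\<close> \<open>0 \<le> D\<close> \<open>0 \<le> e\<close> \<open>0 < h\<close>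
        by (intro mult_left_mono) (auto simp: algebra_simps intro!: add_nonneg_nonneg)
      then have "h * real ?t * (?\<kappa> * (e + 2 * D * h ^ p)) \<le> 2 * T * (?\<kappa> * ((1 + 2 * D) * (h ^ p + e)))"
        by (rule mult_mono[OF ht])
          (use \<open>0 \<le> ?\<kappa>\<close> \<open>0 \<le> D\<close> \<open>0 \<le> e\<close> \<open>0 < h\<close> \<open>0 < T\<close> in simp_all)
      then show "h * (real ?t * (?\<kappa> * (e + 2 * D * h ^ p))) \<le> 2 * T * ((1 + 2 * D) * (?\<kappa> * (h ^ p + e)))"
        by (simp only: mult_ac)
    qed
    also have "\<dots> = K1 * (2 * T) * (1 + 2 * D) * (?\<kappa> * (h ^ p + e)) + K2 * sqrt T * (R * h ^ p)"
      by (simp only: mult_ac)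
    also have "\<dots> \<le> C * (?\<kappa> * (h ^ p + e)) + C * (R * h ^ p)"
      using \<open>0 \<le> K1\<close> \<open>0 \<le> K2\<close> \<open>0 \<le> D\<close> \<open>0 < T\<close> \<open>0 \<le> ?\<kappa>\<close> \<open>0 \<le> e\<close> \<open>0 < h\<close> \<open>0 < R\<close>
      by (intro add_mono mult_right_mono) (auto simp: C_def intro!: mult_nonneg_nonneg add_nonneg_nonneg)
    finally show ?thesis
      by (simp add: g_def h_def distrib_left)
  qed
  show ?thesis
    using \<open>0 < C\<close> main by blast
qed

end
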